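(* Let $X$ be a set and $X'$ a locally compact Hausdorff space. Suppose that $K:X\times X'\to\mathbb{R}$ satisfies $K(x,\cdot)\in C_0(X')$ for every $x\in X$ and that $\mathrm{span}\{K(x,\cdot):x\in X\}$ is dense in $C_0(X')$; let $\mathcal{B}_K$ be the associated RKBS. Let $x_1,\dots,x_n$ be distinct points of $X$ such that $K(x_1,\cdot),\dots,K(x_n,\cdot)$ are linearly independent in $C_0(X')$, and put $\mathcal{V}:=\mathrm{span}\{K(x_j,\cdot):j=1,\dots,n\}$. Let $\mathbf{y}\in\mathbb{R}^n\setminus\{\mathbf{0}\}$, $\mathcal{M}_{\mathbf{y}}:=\{f\in\mathcal{B}_K:f(x_j)=y_j,\ j=1,\dots,n\}$, and let $\mathrm{S}(\mathbf{y})$ be the set of all $f\in\mathcal{M}_{\mathbf{y}}$ with $\|f\|_{\mathcal{B}_K}=\inf\{\|h\|_{\mathcal{B}_K}:h\in\mathcal{M}_{\mathbf{y}}\}$. Suppose $\hat g\in\mathcal{V}$ satisfies $$(\|\hat g\|_\infty\,\mathrm{co}(\Omega(\hat g)))\cap\mathcal{M}_{\mathbf{y}}\neq\emptyset .$$ If for every nonzero $g\in\mathcal{V}$ the set $\mathcal{N}(g)$ is finite, then for every extreme point $\hat f$ of $\mathrm{S}(\mathbf{y})$ there exist a positive integer $M\le\mathrm{rank}(\mathbf{V}_{\hat g})$, real numbers $\hat\alpha_j\neq0$, $j=1,\dots,M$, with $\sum_{j=1}^M|\hat\alpha_j|=\|\hat g\|_\infty$, and points $x_j'\in\mathcal{N}(\hat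 g)$, $j=1,\dots,M$, such that $$\hat f=\sum_{j=1}^M\hat\alpha_jK(\cdot,x_j').$$
   Context: $C_0(X')$ is the Banach space of continuous $f:X'\to\mathbb{R}$ such that $\{x':|f(x')|\ge\epsilon\}$ is compact for all $\epsilon>0$, with the norm $\|f\|_\infty=\sup_{x'\in X'}|f(x')|$. $\mathfrak{M}(X')$ is the space of real-valued regular Borel measures on $X'$ with total variation norm $\|\cdot\|_{\mathrm{TV}}$ (the dual of $C_0(X')$). The space $\mathcal{B}_K$ of functions on $X$ is $$\mathcal{B}_K:=\Bigl\{f_\mu:=\int_{X'}K(\cdot,x')\,d\mu(x'):\mu\in\mathfrak{M}(X')\Bigr\},\qquad\|f_\mu\|_{\mathcal{B}_K}:=\|\mu\|_{\mathrm{TV}}$$ (by the density condition $\mu\mapsto f_\mu$ is injective). For $g\in C_0(X')$: $\mathcal{N}(g):=\{x'\in X':|g(x')|=\|g\|_\infty\}$ and $\Omega(g):=\{\mathrm{sign}(g(x'))K(\cdot,x'):x'\in\mathcal{N}(g)\}\subset\mathcal{B}_K$; $\mathrm{co}$ denotes convex hull. For nonzero $g\in\mathcal{V}$ with $\mathcal{N}(g)$ finite, let $n(g)$ be the cardinality of $\mathcal{N}(g)=\{t_1',\dots,t'_{n(g)}\}$ and $\mathbf{V}_g:=[K(x_i,t_j')]_{1\le i\le n,\,1\le j\le n(g)}\in\mathbb{R}^{n\times n(g)}$. (The hypothesis on $\hat g$ together with $\mathbf{y}\ne\mathbf{0}$ forces $\hat g\ne0$.) *)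

theory Defs
  imports
    "HOL-Analysis.Analysis"
    "HOL-Library.Function_Algebras"
    "Jordan_Normal_Form.DL_Rank"
begin

instantiation "fun" :: (type, real_vector) real_vector
begin

definition scaleR_fun :: "real \<Rightarrow> ('a \<Rightarrow> 'b) \<Rightarrow> 'a \<Rightarrow> 'b"
  where "scaleR_fun c f = (\<lambda>x. c *\<^sub>R f x)"

instance
  by standard (auto simp: scaleR_fun_def fun_eq_iff algebra_simps)

end

definition C0 :: "('b::topological_space \<Rightarrow> real) set"
  where "C0 = {f. continuous_on UNIV f \<and> (\<forall>\<epsilon>>0. compact {t. \<bar>f t\<bar> \<ge> \<epsilon>})}"

definition sup_norm :: "('b \<Rightarrow> real) \<Rightarrow> real"
  where "sup_norm f = (SUP t. \<bar>f t\<bar>)"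

text \<open>
  A signed measure is a real-valued set function. It is required to vanish outside the Borel
  sets, so that two measures that agree on all Borel sets are equal.
\<close>

definition signed_borel_measure :: "('b::topological_space set \<Rightarrow> real) \<Rightarrow> bool"
  where "signed_borel_measure \<mu> \<longleftrightarrow>
    (\<forall>A. A \<notin> sets borel \<longrightarrow> \<mu> A = 0) \<and>
    \<mu> {} = 0 \<and>
    (\<forall>A :: nat \<Rightarrow> 'b set. range A \<subseteq> sets borel \<longrightarrow> disjoint_family A \<longrightarrow>
      (\<lambda>i. \<mu> (A i)) sums \<mu> (\<Union>i. A i))"

definition variation :: "('b::topological_space set \<Rightarrow> real) \<Rightarrow> 'b set \<Rightarrow> ennreal"
  where "variation \<mu> A =
    (SUP P \<in> {P. finite P \<and> P \<subseteq> sets borel \<and> partition_on A P}. \<Sum>B\<in>P. ennreal \<bar>\<mu> B\<bar>)"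

definition tv_norm :: "('b::topological_space set \<Rightarrow> real) \<Rightarrow> real"
  where "tv_norm \<mu> = enn2real (variation \<mu> UNIV)"

text \<open>
  Regularity of a signed measure is regularity of its variation. Finiteness on compact sets
  needs no mention: a real-valued signed measure has finite total variation.
\<close>

definition regular_measures :: "('b::topological_space set \<Rightarrow> real) set"
  where "regular_measures = {\<mu>. signed_borel_measure \<mu> \<and>
    (\<forall>A \<in> sets borel.
      variation \<mu> A = (SUP C \<in> {C. compact C \<and> C \<in> sets borel \<and> C \<subseteq> A}. variation \<mu> C) \<and>
      variation \<mu> A = (INF U \<in> {U. open U \<and> A \<subseteq> U}. variation \<mu> U))}"

text \<open>
  Integration goes through the Jordan decomposition
  \<open>\<mu> = \<mu>\<^sup>+ - \<mu>\<^sup>-\<close> with \<open>\<mu>\<^sup>+ = (\<bar>\<mu>\<bar> + \<mu>) / 2\<close> and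
  \<open>\<mu>\<^sup>- = (\<bar>\<mu>\<bar> - \<mu>) / 2\<close>, where \<open>\<bar>\<mu>\<bar>\<close> is the (finite) variation.
\<close>

definition positive_part :: "('b::topological_space set \<Rightarrow> real) \<Rightarrow> 'b measure"
  where "positive_part \<mu> =
    measure_of UNIV (sets borel) (\<lambda>A. ennreal ((enn2real (variation \<mu> A) + \<mu> A) / 2))"

definition negative_part :: "('b::topological_space set \<Rightarrow> real) \<Rightarrow> 'b measure"
  where "negative_part \<mu> =
    measure_of UNIV (sets borel) (\<lambda>A. ennreal ((enn2real (variation \<mu> A) - \<mu> A) / 2))"

definition signed_integral :: "('b::topological_space set \<Rightarrow> real) \<Rightarrow> ('b \<Rightarrow> real) \<Rightarrow> real"
  where "signed_integral \<mu> f = (\<integral>t. f t \<partial>positive_part \<mu>) - (\<integral>t. f t \<partial>negative_part \<mu>)"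

definition kernel_integral ::
    "('a \<Rightarrow> 'b::topological_space \<Rightarrow> real) \<Rightarrow> ('b set \<Rightarrow> real) \<Rightarrow> 'a \<Rightarrow> real"
  where "kernel_integral K \<mu> = (\<lambda>x. signed_integral \<mu> (K x))"

definition rkbs :: "('a \<Rightarrow> 'b::topological_space \<Rightarrow> real) \<Rightarrow> ('a \<Rightarrow> real) set"
  where "rkbs K = kernel_integral K ` regular_measures"

text \<open>
  The representing measure is unique when \<open>C0\<close> is the closure of the span of the functions
  \<open>K x\<close>; only then is the following norm meaningful.
\<close>

definition rkbs_norm :: "('a \<Rightarrow> 'b::topological_space \<Rightarrow> real) \<Rightarrow> ('a \<Rightarrow> real) \<Rightarrow> real"
  where "rkbs_norm K f = tv_norm (THE \<mu>. \<mu> \<in> regular_measures \<and> f = kernel_integral K \<mu>)"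

text \<open>The data are indexed by \<open>{..<n}\<close>; values of \<open>x\<close> and \<open>y\<close> at other indices play no role.\<close>

definition interpolants ::
    "('a \<Rightarrow> 'b::topological_space \<Rightarrow> real) \<Rightarrow> nat \<Rightarrow> (nat \<Rightarrow> 'a) \<Rightarrow> (nat \<Rightarrow> real) \<Rightarrow> ('a \<Rightarrow> real) set"
  where "interpolants K n x y = {f \<in> rkbs K. \<forall>j<n. f (x j) = y j}"

definition min_norm_interpolants ::
    "('a \<Rightarrow> 'b::topological_space \<Rightarrow> real) \<Rightarrow> nat \<Rightarrow> (nat \<Rightarrow> 'a) \<Rightarrow> (nat \<Rightarrow> real) \<Rightarrow> ('a \<Rightarrow> real) set"
  where "min_norm_interpolants K n x y =
    {f \<in> interpolants K n x y. rkbs_norm K f = (INF h \<in> interpolants K n x y. rkbs_norm K h)}"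

definition norming_points :: "('b \<Rightarrow> real) \<Rightarrow> 'b set"
  where "norming_points g = {t. \<bar>g t\<bar> = sup_norm g}"

definition signed_kernels :: "('a \<Rightarrow> 'b \<Rightarrow> real) \<Rightarrow> ('b \<Rightarrow> real) \<Rightarrow> ('a \<Rightarrow> real) set"
  where "signed_kernels K g = (\<lambda>t. sgn (g t) *\<^sub>R (\<lambda>x. K x t)) ` norming_points g"

text \<open>
  For finite \<open>norming_points g\<close>, the function \<open>from_nat_into (norming_points g)\<close> enumerates it
  bijectively by \<open>{..<card (norming_points g)}\<close>.
\<close>

definition kernel_matrix ::
    "('a \<Rightarrow> 'b \<Rightarrow> real) \<Rightarrow> nat \<Rightarrow> (nat \<Rightarrow> 'a) \<Rightarrow> ('b \<Rightarrow> real) \<Rightarrow> real mat"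
  where "kernel_matrix K n x g =
    Matrix.mat n (card (norming_points g))
      (\<lambda>(i, j). K (x i) (from_nat_into (norming_points g) j))"

end

theory Submission
  imports Defs
begin

text \<open>
  Write \<open>s\<close> for the supremum norm of \<open>g_hat\<close>. By hypothesis some interpolant is \<open>s\<close> times a convex
  combination of the functions \<open>sgn (g_hat t) K(\<cdot>, t)\<close> at norming points \<open>t\<close>. It is represented by a
  combination of point masses of total variation at most \<open>s\<close>, against which \<open>g_hat\<close> integrates
  to \<open>s\<^sup>2\<close>. All interpolating measures integrate \<open>g_hat\<close> to the same number, because \<open>g_hat\<close> is a
  combination of the \<open>K(x\<^sub>j, \<cdot>)\<close>. Since an integral of \<open>g_hat\<close> is at most \<open>s\<close> times the total
  variation, the minimal norm is \<open>s\<close>, and every minimal measure attains the norm of \<open>g_hat\<close>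
  (\<open>min_norm_interpolants_eq\<close>).

  A measure that attains the norm of \<open>g_hat\<close> lives on the norming points and has the sign of \<open>g_hat\<close>
  there (\<open>norm_attaining_measure\<close>). As \<open>y\<close> is not zero, neither is \<open>g_hat\<close>; so there are only finitely
  many norming points, and the minimal interpolant \<open>f_hat\<close> is \<open>\<Sum>t\<in>P. a t K(\<cdot>, t)\<close> with nonzero \<open>a t\<close>
  and \<open>\<Sum>t\<in>P. \<bar>a t\<bar> = s\<close>. If the columns of the kernel matrix at the points of \<open>P\<close> were linearly
  dependent, moving \<open>a\<close> a little in both directions along a dependency would exhibit \<open>f_hat\<close> as a
  proper midpoint of two minimal interpolants (\<open>extreme_point_indep\<close>). So for an extreme point the
  columns are independent, and the number of points is at most the rank
  (\<open>card_le_rank_kernel_matrix\<close>).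

  Two facts from measure theory carry this. The variation of a signed measure and its Jordan parts
  are finite measures; this comes from the Hahn decomposition (\<open>Hahn_decomposition\<close>). A
  regular signed measure is determined by its integrals over \<open>C0\<close>, and by density already by those
  of the kernel sections (\<open>kernel_integral_inj\<close>). The second fact gives the norm of the space its
  meaning, and at the end it tells the two perturbed interpolants apart.
\<close>

section \<open>Signed measures and their Hahn decomposition\<close>

lemma signed_measure_empty: "signed_borel_measure \<mu> \<Longrightarrow> \<mu> {} = 0"
  by (simp add: signed_borel_measure_def)

lemma signed_measure_nonborel: "signed_borel_measure \<mu> \<Longrightarrow> A \<notin> sets borel \<Longrightarrow> \<mu> A = 0"
  by (simp add: signed_borel_measure_def)

lemma signed_measure_sums:
  assumes "signed_borel_measure \<mu>" "\<And>i. A i \<in> sets borel" "disjoint_family A"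
  shows "(\<lambda>i::nat. \<mu> (A i)) sums \<mu> (\<Union>i. A i)"
  using assms unfolding signed_borel_measure_def by (auto simp: image_subset_iff)

lemma signed_measure_Un:
  assumes "signed_borel_measure \<mu>" "A \<in> sets borel" "B \<in> sets borel" "A \<inter> B = {}"
  shows "\<mu> (A \<union> B) = \<mu> A + \<mu> B"
proof -
  have "disjoint_family (binaryset A B)"
    using assms(4) by (auto simp: disjoint_family_on_def binaryset_def)
  moreover have "binaryset A B i \<in> sets borel" for i
    using assms by (simp add: binaryset_def)
  ultimately have "(\<lambda>i. \<mu> (binaryset A B i)) sums \<mu> (\<Union>i. binaryset A B i)"
    using assms(1) by (intro signed_measure_sums) auto
  moreover have "(\<lambda>i. \<mu> (binaryset A B i)) sums (\<mu> A + \<mu> B)"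
    by (intro binaryset_sums signed_measure_empty assms)
  ultimately show ?thesis
    by (simp add: UN_binaryset_eq sums_unique2)
qed

lemma signed_measure_split:
  assumes "signed_borel_measure \<mu>" "A \<in> sets borel" "B \<in> sets borel"
  shows "\<mu> A = \<mu> (A \<inter> B) + \<mu> (A - B)"
proof -
  have "(A \<inter> B) \<union> (A - B) = A" by auto
  then show ?thesis
    using signed_measure_Un[of \<mu> "A \<inter> B" "A - B"] assms by (simp add: Int_Diff_disjoint)
qed

text \<open>
  The family may repeat the empty set; this makes the lemma applicable to the traces of a partition
  on a fixed set, where distinct blocks can have the same (empty) trace.
\<close>

lemma signed_measure_finite_UN:
  assumes "signed_borel_measure \<mu>" "finite I" "\<And>i. i \<in> I \<Longrightarrow> F i \<in> sets borel"
    "disjoint_family_on F I"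
  shows "\<mu> (\<Union>i\<in>I. F i) = (\<Sum>i\<in>I. \<mu> (F i))"
  using assms(2-)
proof (induction I rule: finite_induct)
  case empty
  then show ?case using assms(1) by (simp add: signed_measure_empty)
next
  case (insert i I)
  have "F i \<inter> (\<Union>j\<in>I. F j) = {}"
    using insert.hyps(2) insert.prems(2) by (fastforce simp: disjoint_family_on_def)
  then have "\<mu> (F i \<union> (\<Union>j\<in>I. F j)) = \<mu> (F i) + \<mu> (\<Union>j\<in>I. F j)"
    using insert.hyps(1) insert.prems(1) assms(1) by (intro signed_measure_Un) auto
  moreover have "\<mu> (\<Union>j\<in>I. F j) = (\<Sum>j\<in>I. \<mu> (F j))"
    using insert.prems by (intro insert.IH) (auto simp: disjoint_family_on_def)
  ultimately show ?case
    using insert.hyps by simp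
qed

definition positive_set :: "('b::topological_space set \<Rightarrow> real) \<Rightarrow> 'b set \<Rightarrow> bool"
  where "positive_set \<mu> A \<longleftrightarrow> A \<in> sets borel \<and> (\<forall>B \<in> sets borel. B \<subseteq> A \<longrightarrow> 0 \<le> \<mu> B)"

lemma positive_set_mono:
  assumes "signed_borel_measure \<mu>" "positive_set \<mu> A" "B \<in> sets borel" "B \<subseteq> A"
  shows "\<mu> B \<le> \<mu> A"
proof -
  have "\<mu> A = \<mu> (A \<inter> B) + \<mu> (A - B)"
    using assms by (intro signed_measure_split) (auto simp: positive_set_def)
  moreover have "A \<inter> B = B" using assms by auto
  moreover have "0 \<le> \<mu> (A - B)"
    using assms by (auto simp: positive_set_def)
  ultimately show ?thesis by simp
qed

lemma positive_set_UN:
  assumes "signed_borel_measure \<mu>" "\<And>n::nat. positive_set \<mu> (A n)"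
  shows "positive_set \<mu> (\<Union>n. A n)"
  unfolding positive_set_def
proof (intro conjI ballI impI)
  have meas: "A n \<in> sets borel" for n
    using assms(2) by (simp add: positive_set_def)
  then show "(\<Union>n. A n) \<in> sets borel" by auto
  fix B :: "'a set" assume B: "B \<in> sets borel" "B \<subseteq> (\<Union>n. A n)"
  have dA: "disjointed A n \<in> sets borel" for n
    using sets.range_disjointed_sets[of A borel] meas by auto
  have "(\<lambda>n. \<mu> (B \<inter> disjointed A n)) sums \<mu> (\<Union>n. B \<inter> disjointed A n)"
  proof (rule signed_measure_sums[OF assms(1)])
    show "disjoint_family (\<lambda>n. B \<inter> disjointed A n)"
      using disjoint_family_disjointed[of A] by (auto simp: disjoint_family_on_def)
  qed (use B dA in auto)
  moreover have "(\<Union>n. B \<inter> disjointed A n) = B"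
    using B(2) UN_disjointed_eq[of A] by auto
  moreover have "0 \<le> \<mu> (B \<inter> disjointed A n)" for n
  proof -
    have "B \<inter> disjointed A n \<subseteq> A n" using disjointed_subset[of A n] by blast
    then show ?thesis
      using assms(2)[of n] sets.Int[OF B(1) dA] by (simp add: positive_set_def)
  qed
  ultimately show "0 \<le> \<mu> B"
    using sums_le[OF _ sums_zero, of "\<lambda>n. \<mu> (B \<inter> disjointed A n)" "\<mu> B"] by simp
qed

text \<open>
  Remove from \<open>D\<close> again and again a set that has at least half of the negative mass that a single
  subset of the rest can have (or mass at most \<open>-1\<close>). The masses of the removed sets form a
  convergent series, so they tend to zero, and no set of negative mass survives.
\<close>

lemma positive_subset_exists:
  assumes \<mu>: "signed_borel_measure \<mu>" and D: "D \<in> sets borel"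
  shows "\<exists>A. positive_set \<mu> A \<and> A \<subseteq> D \<and> \<mu> D \<le> \<mu> A"
proof -
  have "\<exists>B \<in> sets borel. B \<subseteq> A \<and> (\<forall>C \<in> sets borel. C \<subseteq> A \<longrightarrow> min 1 (- \<mu> C / 2) \<le> - \<mu> B)"
    for A
  proof (cases "bdd_above {- \<mu> C |C. C \<in> sets borel \<and> C \<subseteq> A}")
    case False
    then have "\<not> (\<forall>v \<in> {- \<mu> C |C. C \<in> sets borel \<and> C \<subseteq> A}. v \<le> 1)"
      unfolding bdd_above_def not_ex by (rule spec)
    then obtain B where "B \<in> sets borel" "B \<subseteq> A" "1 < - \<mu> B" by (auto simp: not_le)
    then show ?thesis by (intro bexI[of _ B]) auto
  next
    case bdd: True
    define s where "s = Sup {- \<mu> C |C. C \<in> sets borel \<and> C \<subseteq> A}"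
    have up: "- \<mu> C \<le> s" if "C \<in> sets borel" "C \<subseteq> A" for C
      unfolding s_def using that bdd by (intro cSup_upper) auto
    have "0 \<le> s" using up[of "{}"] \<mu> by (simp add: signed_measure_empty)
    then consider "s = 0" | "0 < s" by linarith
    then show ?thesis
    proof cases
      case 1
      then show ?thesis
        using up \<mu> by (intro bexI[of _ "{}"]) (force simp: signed_measure_empty)+
    next
      case 2
      then have "s / 2 < s" by simp
      then have "\<exists>v \<in> {- \<mu> C |C. C \<in> sets borel \<and> C \<subseteq> A}. s / 2 < v"
        unfolding s_def by (intro less_cSupD) auto
      then obtain B where "B \<in> sets borel" "B \<subseteq> A" "s / 2 < - \<mu> B" by auto
      then show ?thesis
        using up by (intro bexI[of _ B]) (force simp: min_le_iff_disj)+
    qed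
  qed
  then obtain f where f: "\<And>A. f A \<in> sets borel" "\<And>A. f A \<subseteq> A"
    "\<And>A C. C \<in> sets borel \<Longrightarrow> C \<subseteq> A \<Longrightarrow> min 1 (- \<mu> C / 2) \<le> - \<mu> (f A)"
    by metis
  define R where "R n = ((\<lambda>A. A - f A) ^^ n) D" for n
  have R_Suc: "R (Suc n) = R n - f (R n)" for n by (simp add: R_def)
  have R_meas: "R n \<in> sets borel" for n
  proof (induction n)
    case 0 then show ?case using D by (simp add: R_def)
  qed (use f(1) in \<open>auto simp: R_Suc\<close>)
  have "decseq R" by (rule decseq_SucI) (auto simp: R_Suc)
  then have R_anti: "R n \<subseteq> R m" if "m \<le> n" for m n
    using that by (auto dest: decseqD)
  have disj_less: "f (R m) \<inter> f (R n) = {}" if "m < n" for m n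
    using f(2)[of "R n"] R_anti[of "Suc m" n] that by (auto simp: R_Suc)
  then have "disjoint_family (\<lambda>n. f (R n))"
    unfolding disjoint_family_on_def by (metis Int_commute linorder_neqE_nat)
  then have sums: "(\<lambda>n. \<mu> (f (R n))) sums \<mu> (\<Union>n. f (R n))"
    by (intro signed_measure_sums \<mu> f(1))
  have neg: "\<mu> (f (R n)) \<le> 0" for n
    using f(3)[of "{}" "R n"] \<mu> by (simp add: signed_measure_empty)
  have "\<mu> (\<Union>n. f (R n)) \<le> 0"
    using sums_le[OF neg sums sums_zero] .
  define A where "A = D - (\<Union>n. f (R n))"
  have A_meas: "A \<in> sets borel" using D f(1) by (auto simp: A_def)
  have A_R: "A \<subseteq> R n" for n
  proof (induction n)
    case 0 then show ?case by (auto simp: R_def A_def)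
  next
    case (Suc n) then show ?case by (auto simp: R_Suc A_def)
  qed
  have "D \<inter> (\<Union>n. f (R n)) = (\<Union>n. f (R n))"
    using f(2) R_anti[of 0] by (fastforce simp: R_def)
  then have "\<mu> D = \<mu> (\<Union>n. f (R n)) + \<mu> A"
    using signed_measure_split[of \<mu> D "\<Union>n. f (R n)"] \<mu> D f(1) by (auto simp: A_def)
  with \<open>\<mu> (\<Union>n. f (R n)) \<le> 0\<close> have "\<mu> D \<le> \<mu> A" by simp
  moreover have "0 \<le> \<mu> C" if C: "C \<in> sets borel" "C \<subseteq> A" for C
  proof (rule ccontr)
    assume "\<not> 0 \<le> \<mu> C"
    have "(\<lambda>n. - \<mu> (f (R n))) \<longlonglongrightarrow> 0"
      using tendsto_minus[OF summable_LIMSEQ_zero[OF sums_summable[OF sums]]] by simp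
    then have "min 1 (- \<mu> C / 2) \<le> 0"
      by (rule LIMSEQ_le_const) (use f(3) C A_R in \<open>blast\<close>)
    with \<open>\<not> 0 \<le> \<mu> C\<close> show False by (simp add: min_def split: if_splits)
  qed
  ultimately show ?thesis
    using A_meas by (intro exI[of _ A]) (auto simp: positive_set_def A_def)
qed

definition Hahn_set :: "('b::topological_space set \<Rightarrow> real) \<Rightarrow> 'b set \<Rightarrow> bool"
  where "Hahn_set \<mu> P \<longleftrightarrow>
    positive_set \<mu> P \<and> (\<forall>B \<in> sets borel. B \<inter> P = {} \<longrightarrow> \<mu> B \<le> 0)"

lemma Hahn_setD:
  assumes "Hahn_set \<mu> P"
  shows "P \<in> sets borel"
    and "\<And>A. A \<in> sets borel \<Longrightarrow> 0 \<le> \<mu> (A \<inter> P)"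
    and "\<And>A. A \<in> sets borel \<Longrightarrow> \<mu> (A - P) \<le> 0"
  using assms by (auto simp: Hahn_set_def positive_set_def)

text \<open>
  A positive set of maximal mass does it: its complement has no subset of positive mass, because
  such a subset would contain a positive set to be added.
\<close>

lemma Hahn_decomposition:
  assumes \<mu>: "signed_borel_measure \<mu>"
  shows "\<exists>P. Hahn_set \<mu> P"
proof -
  have "positive_set \<mu> {}" using \<mu> by (simp add: positive_set_def signed_measure_empty)
  let ?M = "{\<mu> A |A. positive_set \<mu> A}"
  have union: "\<exists>P. positive_set \<mu> P \<and> (\<forall>n. \<mu> (A n) \<le> \<mu> P)"
    if "\<And>n. positive_set \<mu> (A n)" for A :: "nat \<Rightarrow> _"
  proof (intro exI[of _ "\<Union>n. A n"] conjI allI)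
    show *: "positive_set \<mu> (\<Union>n. A n)" using \<mu> that by (rule positive_set_UN)
    show "\<mu> (A n) \<le> \<mu> (\<Union>n. A n)" for n
      using that[of n] by (intro positive_set_mono[OF \<mu> *]) (auto simp: positive_set_def)
  qed
  \<comment> \<open>The union of positive sets of unbounded mass would have infinite mass.\<close>
  have "bdd_above ?M"
  proof (rule ccontr)
    assume "\<not> bdd_above ?M"
    then have "\<exists>A. positive_set \<mu> A \<and> real n < \<mu> A" for n
      unfolding bdd_above_def by (force simp: not_le)
    then obtain A where A: "\<And>n. positive_set \<mu> (A n)" "\<And>n. real n < \<mu> (A n)" by metis
    have "\<exists>P. positive_set \<mu> P \<and> (\<forall>n. \<mu> (A n) \<le> \<mu> P)"
      by (rule union) (rule A(1))
    then obtain P where "\<And>n. \<mu> (A n) \<le> \<mu> P" by auto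
    with A(2) have P: "real n < \<mu> P" for n by (rule less_le_trans)
    obtain n where "\<mu> P < real n" using reals_Archimedean2 by blast
    with P[of n] show False by simp
  qed
  define s where "s = Sup ?M"
  have up: "\<mu> A \<le> s" if "positive_set \<mu> A" for A
    unfolding s_def using that \<open>bdd_above ?M\<close> by (intro cSup_upper) auto
  have "\<exists>A. positive_set \<mu> A \<and> s - inverse (real (Suc n)) < \<mu> A" for n
  proof -
    have "\<exists>v \<in> ?M. Sup ?M - inverse (real (Suc n)) < v"
      using \<open>positive_set \<mu> {}\<close> by (intro less_cSupD) auto
    then show ?thesis by (auto simp: s_def)
  qed
  then obtain A where A_pos: "\<And>n. positive_set \<mu> (A n)"
    and A: "\<And>n. s - inverse (real (Suc n)) < \<mu> (A n)" by metis
  have "\<exists>P. positive_set \<mu> P \<and> (\<forall>n. \<mu> (A n) \<le> \<mu> P)"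
    by (rule union) (rule A_pos)
  then obtain P where P: "positive_set \<mu> P" "\<And>n. \<mu> (A n) \<le> \<mu> P" by auto
  have "s - 0 \<le> \<mu> P"
  proof (rule LIMSEQ_le_const2)
    show "(\<lambda>n. s - inverse (real (Suc n))) \<longlonglongrightarrow> s - 0"
      by (intro tendsto_intros LIMSEQ_inverse_real_of_nat)
    show "\<exists>N. \<forall>n\<ge>N. s - inverse (real (Suc n)) \<le> \<mu> P"
      using A P(2) by (meson less_imp_le less_le_trans)
  qed
  then have max: "\<mu> B \<le> \<mu> P" if "positive_set \<mu> B" for B
    using up[OF that] by simp
  show ?thesis
    unfolding Hahn_set_def
  proof (intro exI[of _ P] conjI ballI impI P(1), rule ccontr)
    fix B :: "'a set" assume B: "B \<in> sets borel" "B \<inter> P = {}" "\<not> \<mu> B \<le> 0"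
    obtain Q where Q: "positive_set \<mu> Q" "Q \<subseteq> B" "\<mu> B \<le> \<mu> Q"
      using positive_subset_exists[OF \<mu> B(1)] by blast
    have "positive_set \<mu> (\<Union>n::nat. if n = 0 then P else Q)"
      using P(1) Q(1) \<mu> by (intro positive_set_UN) auto
    moreover have "(\<Union>n::nat. if n = 0 then P else Q) = P \<union> Q"
      by (auto split: if_splits)
    ultimately have "\<mu> (P \<union> Q) \<le> \<mu> P" using max by simp
    moreover have "\<mu> (P \<union> Q) = \<mu> P + \<mu> Q"
      using P(1) Q B(2) \<mu> by (intro signed_measure_Un) (auto simp: positive_set_def)
    ultimately show False using Q(3) B(3) by simp
  qed
qed

section \<open>Variation and Jordan decomposition\<close>

text \<open>
  On each block the positive part of the mass sits in \<open>P\<close> and the negative part outside, so no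
  partition can beat the two-block partition into \<open>A \<inter> P\<close> and \<open>A - P\<close>. In particular the variation
  is finite and countably additive, neither of which is visible from its definition as a supremum.
\<close>

lemma variation_Hahn:
  assumes \<mu>: "signed_borel_measure \<mu>" and P: "Hahn_set \<mu> P"
    and A: "A \<in> sets borel"
  shows "variation \<mu> A = ennreal (\<mu> (A \<inter> P) - \<mu> (A - P))"
proof (rule antisym)
  note P_meas = Hahn_setD(1)[OF P] and pos_part = Hahn_setD(2,3)[OF P]
  have le: "\<bar>\<mu> B\<bar> \<le> \<mu> (B \<inter> P) - \<mu> (B - P)" if "B \<in> sets borel" for B
    using signed_measure_split[OF \<mu> that P_meas] pos_part[OF that] by simp
  show "variation \<mu> A \<le> ennreal (\<mu> (A \<inter> P) - \<mu> (A - P))"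
    unfolding variation_def
  proof (rule SUP_least, clarify)
    fix Q assume Q: "finite Q" "Q \<subseteq> sets borel" "partition_on A Q"
    have disj: "disjoint_family_on (\<lambda>B. B \<inter> P) Q" "disjoint_family_on (\<lambda>B. B - P) Q"
      using Q(3) by (fastforce simp: partition_on_def disjoint_family_on_def disjoint_def)+
    have "(\<Sum>B\<in>Q. \<mu> (B \<inter> P)) = \<mu> (\<Union>B\<in>Q. B \<inter> P)"
      using Q P_meas by (intro signed_measure_finite_UN[symmetric] \<mu> disj) auto
    moreover have "(\<Sum>B\<in>Q. \<mu> (B - P)) = \<mu> (\<Union>B\<in>Q. B - P)"
      using Q P_meas by (intro signed_measure_finite_UN[symmetric] \<mu> disj) auto
    moreover have "(\<Union>B\<in>Q. B \<inter> P) = A \<inter> P" "(\<Union>B\<in>Q. B - P) = A - P"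
      using Q(3) by (auto simp: partition_on_def)
    moreover have "(\<Sum>B\<in>Q. \<bar>\<mu> B\<bar>) \<le> (\<Sum>B\<in>Q. \<mu> (B \<inter> P) - \<mu> (B - P))"
      using Q(2) by (intro sum_mono le) auto
    ultimately have "(\<Sum>B\<in>Q. \<bar>\<mu> B\<bar>) \<le> \<mu> (A \<inter> P) - \<mu> (A - P)"
      by (simp add: sum_subtractf)
    then show "(\<Sum>B\<in>Q. ennreal \<bar>\<mu> B\<bar>) \<le> ennreal (\<mu> (A \<inter> P) - \<mu> (A - P))"
      by (simp add: ennreal_leI)
  qed
  \<comment> \<open>A partition has no empty block, so an empty piece has to be dropped.\<close>
  let ?Q = "{A \<inter> P, A - P} - {{}}"
  have "(\<Sum>B\<in>?Q. \<bar>\<mu> B\<bar>) = (\<Sum>B\<in>{A \<inter> P, A - P}. \<bar>\<mu> B\<bar>)"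
    using \<mu> by (intro sum.mono_neutral_left) (auto simp: signed_measure_empty)
  also have "\<dots> = \<mu> (A \<inter> P) - \<mu> (A - P)"
  proof (cases "A \<inter> P = A - P")
    case True
    then have "A \<inter> P = {}" "A - P = {}" by auto
    then show ?thesis unfolding \<open>A \<inter> P = {}\<close> \<open>A - P = {}\<close>
      using \<mu> by (simp add: signed_measure_empty)
  next
    case False
    then show ?thesis using pos_part[OF A] by simp
  qed
  finally have "ennreal (\<mu> (A \<inter> P) - \<mu> (A - P)) = (\<Sum>B\<in>?Q. ennreal \<bar>\<mu> B\<bar>)"
    by simp
  also have "\<dots> \<le> variation \<mu> A"
    unfolding variation_def
    using A P_meas by (intro SUP_upper) (auto simp: partition_on_def disjoint_def)
  finally show "ennreal (\<mu> (A \<inter> P) - \<mu> (A - P)) \<le> variation \<mu> A" .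
qed

lemma sets_positive_part [simp, measurable_cong]: "sets (positive_part \<mu>) = sets borel"
  unfolding positive_part_def
  using sets.sigma_sets_eq[of "borel :: 'a measure"] by (simp add: sets_measure_of_conv)

text \<open>
  \<open>measure_of\<close> yields the zero measure unless the given set function is countably additive. The
  Hahn set supplies this: on Borel sets, half the sum of \<open>\<mu>\<close> and its variation is the restriction
  of \<open>\<mu>\<close> to \<open>P\<close>.
\<close>

lemma emeasure_positive_part_Hahn:
  assumes \<mu>: "signed_borel_measure \<mu>" and P: "Hahn_set \<mu> P"
    and A: "A \<in> sets borel"
  shows "emeasure (positive_part \<mu>) A = ennreal (\<mu> (A \<inter> P))"
proof -
  note P_meas = Hahn_setD(1)[OF P] and pos = Hahn_setD(2)[OF P]
  have eq: "(enn2real (variation \<mu> B) + \<mu> B) / 2 = \<mu> (B \<inter> P)" if "B \<in> sets borel" for B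
    using variation_Hahn[OF \<mu> P that] signed_measure_split[OF \<mu> that P_meas]
      Hahn_setD(2,3)[OF P that]
    by simp
  have "emeasure (positive_part \<mu>) A = ennreal ((enn2real (variation \<mu> A) + \<mu> A) / 2)"
  proof (rule emeasure_measure_of[OF positive_part_def])
    show "positive (sets (positive_part \<mu>))
        (\<lambda>A. ennreal ((enn2real (variation \<mu> A) + \<mu> A) / 2))"
      using eq[of "{}"] \<mu> by (simp add: positive_def signed_measure_empty)
    show "countably_additive (sets (positive_part \<mu>))
        (\<lambda>A. ennreal ((enn2real (variation \<mu> A) + \<mu> A) / 2))"
    proof (rule countably_additiveI)
      fix B :: "nat \<Rightarrow> 'a set"
      assume B: "range B \<subseteq> sets (positive_part \<mu>)" "disjoint_family B"
      then have B_meas: "B i \<in> sets borel" for i by auto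
      have "(\<lambda>i. \<mu> (B i \<inter> P)) sums \<mu> (\<Union>i. B i \<inter> P)"
        using B(2) B_meas P_meas
        by (intro signed_measure_sums[OF \<mu>]) (auto simp: disjoint_family_on_def)
      then have "(\<Sum>i. ennreal (\<mu> (B i \<inter> P))) = ennreal (\<mu> ((\<Union>i. B i) \<inter> P))"
        using pos[OF B_meas] by (intro suminf_ennreal_eq) auto
      moreover have "(\<Union>i. B i) \<in> sets borel" using B_meas by auto
      ultimately show "(\<Sum>i. ennreal ((enn2real (variation \<mu> (B i)) + \<mu> (B i)) / 2)) =
          ennreal ((enn2real (variation \<mu> (\<Union>i. B i)) + \<mu> (\<Union>i. B i)) / 2)"
        by (simp only: eq[OF B_meas] eq)
    qed
  qed (use A in auto)
  with eq[OF A] show ?thesis by simp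
qed

lemma signed_measure_uminus:
  assumes "signed_borel_measure \<mu>"
  shows "signed_borel_measure (\<lambda>A. - \<mu> A)"
  using assms unfolding signed_borel_measure_def by (auto intro: sums_minus)

lemma negative_part_eq: "negative_part \<mu> = positive_part (\<lambda>A. - \<mu> A)"
  by (simp add: negative_part_def positive_part_def variation_def)

lemma sets_negative_part [simp, measurable_cong]: "sets (negative_part \<mu>) = sets borel"
  by (simp add: negative_part_eq)

lemma emeasure_negative_part_Hahn:
  assumes \<mu>: "signed_borel_measure \<mu>" and P: "Hahn_set \<mu> P"
    and A: "A \<in> sets borel"
  shows "emeasure (negative_part \<mu>) A = ennreal (- \<mu> (A - P))"
proof -
  have "Hahn_set (\<lambda>A. - \<mu> A) (- P)"
    using P by (auto simp: Hahn_set_def positive_set_def)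
  then show ?thesis
    using emeasure_positive_part_Hahn[OF signed_measure_uminus[OF \<mu>], of "- P" A] A
    by (simp add: negative_part_eq Diff_eq)
qed

text \<open>
  Everything the rest of the development needs to know about the Jordan decomposition, freed from
  the choice of a Hahn set.
\<close>

lemma
  assumes "signed_borel_measure \<mu>"
  shows finite_positive_part: "finite_measure (positive_part \<mu>)"
    and finite_negative_part: "finite_measure (negative_part \<mu>)"
    and variation_eq_emeasure: "\<And>A. A \<in> sets borel \<Longrightarrow>
      variation \<mu> A = emeasure (positive_part \<mu>) A + emeasure (negative_part \<mu>) A"
    and variation_eq_measure: "\<And>A. A \<in> sets borel \<Longrightarrow>
      variation \<mu> A = ennreal (measure (positive_part \<mu>) A + measure (negative_part \<mu>) A)"
    and signed_measure_eq_diff: "\<And>A. A \<in> sets borel \<Longrightarrow>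
      \<mu> A = measure (positive_part \<mu>) A - measure (negative_part \<mu>) A"
proof -
  obtain P where P: "Hahn_set \<mu> P"
    using Hahn_decomposition[OF assms] by auto
  note P_meas = Hahn_setD(1)[OF P] and sgn = Hahn_setD(2,3)[OF P]
  note p = emeasure_positive_part_Hahn[OF assms P] and n = emeasure_negative_part_Hahn[OF assms P]
  have "space (positive_part \<mu>) = UNIV" "space (negative_part \<mu>) = UNIV"
    by (simp_all add: sets_eq_imp_space_eq[OF sets_positive_part]
        sets_eq_imp_space_eq[OF sets_negative_part])
  then show "finite_measure (positive_part \<mu>)" "finite_measure (negative_part \<mu>)"
    using p[of UNIV] n[of UNIV] by (auto intro!: finite_measureI)
  fix A :: "'a set" assume A: "A \<in> sets borel"
  have m: "measure (positive_part \<mu>) A = \<mu> (A \<inter> P)" "measure (negative_part \<mu>) A = - \<mu> (A - P)"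
    using p[OF A] n[OF A] sgn[OF A] by (simp_all add: measure_def)
  show "variation \<mu> A = emeasure (positive_part \<mu>) A + emeasure (negative_part \<mu>) A"
    using variation_Hahn[OF assms P A] p[OF A] n[OF A] sgn[OF A]
    by (simp flip: ennreal_plus)
  show "variation \<mu> A = ennreal (measure (positive_part \<mu>) A + measure (negative_part \<mu>) A)"
    using variation_Hahn[OF assms P A] m by simp
  show "\<mu> A = measure (positive_part \<mu>) A - measure (negative_part \<mu>) A"
    using signed_measure_split[OF assms A P_meas] m by simp
qed

lemma space_positive_part [simp]: "space (positive_part \<mu>) = UNIV"
  by (simp add: sets_eq_imp_space_eq[OF sets_positive_part])

lemma space_negative_part [simp]: "space (negative_part \<mu>) = UNIV"
  by (simp add: sets_eq_imp_space_eq[OF sets_negative_part])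

lemma tv_norm_eq:
  assumes "signed_borel_measure \<mu>"
  shows "tv_norm \<mu> = measure (positive_part \<mu>) UNIV + measure (negative_part \<mu>) UNIV"
  using assms by (simp add: tv_norm_def variation_eq_measure del: ennreal_plus)

text \<open>
  A Hahn set contains no atom of negative mass and its complement none of positive mass, so the
  formula for the variation in terms of a Hahn set turns into the sum of absolute values.
\<close>

lemma variation_concentrated:
  fixes \<mu> :: "'b::t2_space set \<Rightarrow> real"
  assumes \<mu>: "signed_borel_measure \<mu>" and "finite N"
    and null: "\<And>B. B \<in> sets borel \<Longrightarrow> B \<inter> N = {} \<Longrightarrow> \<mu> B = 0"
    and A: "A \<in> sets borel"
  shows "variation \<mu> A = ennreal (\<Sum>t\<in>A \<inter> N. \<bar>\<mu> {t}\<bar>)"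
proof -
  obtain P where P: "Hahn_set \<mu> P"
    using Hahn_decomposition[OF \<mu>] by auto
  note P_meas = Hahn_setD(1)[OF P]
  have atoms: "\<mu> B = (\<Sum>t\<in>B \<inter> N. \<mu> {t})" if B: "B \<in> sets borel" for B
  proof -
    have BN: "B \<inter> N \<in> sets borel" using B \<open>finite N\<close>
      by (intro sets.Int borel_closed) (simp_all add: finite_imp_closed)
    have "\<mu> (B - (B \<inter> N)) = 0" using B BN by (intro null) auto
    moreover have "B \<inter> (B \<inter> N) = B \<inter> N" by auto
    ultimately have "\<mu> B = \<mu> (B \<inter> N)"
      using signed_measure_split[OF \<mu> B BN] by simp
    also have "\<dots> = (\<Sum>t\<in>B \<inter> N. \<mu> {t})"
      using signed_measure_finite_UN[OF \<mu>, of "B \<inter> N" "\<lambda>t. {t}"] \<open>finite N\<close>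
      by (simp add: disjoint_family_on_def)
    finally show ?thesis .
  qed
  have inside: "\<mu> {t} = \<bar>\<mu> {t}\<bar>" if "t \<in> P" for t
    using Hahn_setD(2)[OF P, of "{t}"] that by simp
  have outside: "\<mu> {t} = - \<bar>\<mu> {t}\<bar>" if "t \<notin> P" for t
    using Hahn_setD(3)[OF P, of "{t}"] that by (simp add: insert_Diff_if)
  have "variation \<mu> A = ennreal (\<mu> (A \<inter> P) - \<mu> (A - P))"
    using \<mu> P A by (rule variation_Hahn)
  also have "\<mu> (A \<inter> P) = (\<Sum>t\<in>A \<inter> N \<inter> P. \<bar>\<mu> {t}\<bar>)"
  proof -
    have "A \<inter> P \<inter> N = A \<inter> N \<inter> P" by auto
    then have "\<mu> (A \<inter> P) = (\<Sum>t\<in>A \<inter> N \<inter> P. \<mu> {t})"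
      using atoms[of "A \<inter> P"] A P_meas by simp
    also have "\<dots> = (\<Sum>t\<in>A \<inter> N \<inter> P. \<bar>\<mu> {t}\<bar>)"
      by (rule sum.cong[OF refl], rule inside) simp
    finally show ?thesis .
  qed
  also have "\<mu> (A - P) = - (\<Sum>t\<in>A \<inter> N - P. \<bar>\<mu> {t}\<bar>)"
  proof -
    have "(A - P) \<inter> N = A \<inter> N - P" by auto
    then have "\<mu> (A - P) = (\<Sum>t\<in>A \<inter> N - P. \<mu> {t})"
      using atoms[of "A - P"] A P_meas by simp
    also have "\<dots> = (\<Sum>t\<in>A \<inter> N - P. - \<bar>\<mu> {t}\<bar>)"
      by (rule sum.cong[OF refl], rule outside) simp
    finally show ?thesis by (simp add: sum_negf)
  qed
  also have "(\<Sum>t\<in>A \<inter> N \<inter> P. \<bar>\<mu> {t}\<bar>) - - (\<Sum>t\<in>A \<inter> N - P. \<bar>\<mu> {t}\<bar>) = (\<Sum>t\<in>A \<inter> N. \<bar>\<mu> {t}\<bar>)"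
    using \<open>finite N\<close> by (subst sum.Int_Diff[of "A \<inter> N" _ P]) auto
  finally show ?thesis .
qed

section \<open>Integration against a signed measure\<close>

lemma compact_closed_subset: "compact S \<Longrightarrow> closed T \<Longrightarrow> T \<subseteq> S \<Longrightarrow> compact T"
  using compact_Int_closed[of S T] by (simp add: Int_absorb1)

lemma C0_compact: "f \<in> C0 \<Longrightarrow> 0 < \<epsilon> \<Longrightarrow> compact {t. \<epsilon> \<le> \<bar>f t\<bar>}"
  by (simp add: C0_def)

lemma subspace_C0: "real_vector.subspace (C0 :: ('b::t2_space \<Rightarrow> real) set)"
proof (rule real_vector.subspaceI)
  show "(0 :: 'b \<Rightarrow> real) \<in> C0"
    by (auto simp: C0_def zero_fun_def not_le)
next
  fix f g :: "'b \<Rightarrow> real" assume fg: "f \<in> C0" "g \<in> C0"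
  then have cont: "continuous_on UNIV f" "continuous_on UNIV g" by (auto simp: C0_def)
  have "compact {t. \<epsilon> \<le> \<bar>f t + g t\<bar>}" if "\<epsilon> > 0" for \<epsilon>
  proof -
    have "compact ({t. \<epsilon> / 2 \<le> \<bar>f t\<bar>} \<union> {t. \<epsilon> / 2 \<le> \<bar>g t\<bar>})"
      using that by (intro compact_Un C0_compact fg) simp_all
    moreover have "closed {t. \<epsilon> \<le> \<bar>f t + g t\<bar>}"
      by (intro closed_Collect_le continuous_intros cont)
    moreover have "{t. \<epsilon> \<le> \<bar>f t + g t\<bar>} \<subseteq> {t. \<epsilon> / 2 \<le> \<bar>f t\<bar>} \<union> {t. \<epsilon> / 2 \<le> \<bar>g t\<bar>}"
      by auto
    ultimately show ?thesis
      by (rule compact_closed_subset)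
  qed
  then show "f + g \<in> C0"
    using cont by (auto simp: C0_def plus_fun_def intro!: continuous_intros)
next
  fix c :: real and f :: "'b \<Rightarrow> real" assume f: "f \<in> C0"
  then have cont: "continuous_on UNIV f" by (auto simp: C0_def)
  have "compact {t. \<epsilon> \<le> \<bar>c * f t\<bar>}" if "\<epsilon> > 0" for \<epsilon>
  proof (cases "c = 0")
    case True
    then show ?thesis using that by simp
  next
    case False
    then have "{t. \<epsilon> \<le> \<bar>c * f t\<bar>} = {t. \<epsilon> / \<bar>c\<bar> \<le> \<bar>f t\<bar>}"
      by (auto simp: abs_mult field_simps)
    then show ?thesis using f that False by (auto simp: C0_def)
  qed
  then show "c *\<^sub>R f \<in> C0"
    using cont by (auto simp: C0_def scaleR_fun_def intro!: continuous_intros)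
qed

lemma C0_measurable: "f \<in> C0 \<Longrightarrow> f \<in> borel_measurable borel"
  by (auto simp: C0_def intro: borel_measurable_continuous_onI)

lemma abs_le_sup_norm:
  assumes "f \<in> C0" shows "\<bar>f t\<bar> \<le> sup_norm f"
proof -
  have "compact {t. 1 \<le> \<bar>f t\<bar>}" "continuous_on UNIV f"
    using assms by (auto simp: C0_def)
  then have "bounded (f ` {t. 1 \<le> \<bar>f t\<bar>})"
    by (intro compact_imp_bounded compact_continuous_image) (auto intro: continuous_on_subset)
  then obtain B where B: "\<And>t. 1 \<le> \<bar>f t\<bar> \<Longrightarrow> \<bar>f t\<bar> \<le> B"
    unfolding bounded_iff by auto
  have "\<bar>f t\<bar> \<le> max 1 B" for t
    using B[of t] by (cases "1 \<le> \<bar>f t\<bar>") auto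
  then have "bdd_above (range (\<lambda>t. \<bar>f t\<bar>))"
    by (intro bdd_aboveI[of _ "max 1 B"]) auto
  then show ?thesis
    unfolding sup_norm_def by (intro cSUP_upper) auto
qed

lemma sup_norm_nonneg: "f \<in> C0 \<Longrightarrow> 0 \<le> sup_norm f"
  using abs_le_sup_norm[of f undefined] by linarith

lemma
  assumes "signed_borel_measure \<mu>" "f \<in> C0"
  shows C0_integrable_positive_part: "integrable (positive_part \<mu>) f"
    and C0_integrable_negative_part: "integrable (negative_part \<mu>) f"
  using assms C0_measurable[of f] abs_le_sup_norm[of f]
  by (auto intro!: finite_measure.integrable_const_bound[of _ f "sup_norm f"]
      simp: finite_positive_part finite_negative_part)

lemma signed_integral_add:
  assumes "signed_borel_measure \<mu>" "f \<in> C0" "g \<in> C0"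
  shows "signed_integral \<mu> (f + g) = signed_integral \<mu> f + signed_integral \<mu> g"
  using assms
  by (simp add: signed_integral_def plus_fun_def C0_integrable_positive_part
      C0_integrable_negative_part)

lemma signed_integral_scaleR: "signed_integral \<mu> (c *\<^sub>R f) = c * signed_integral \<mu> f"
  by (simp add: signed_integral_def scaleR_fun_def algebra_simps)

lemma signed_integral_0: "signed_integral \<mu> 0 = 0"
  by (simp add: signed_integral_def zero_fun_def)

lemma signed_integral_bound:
  assumes \<mu>: "signed_borel_measure \<mu>" and f: "f \<in> C0"
  shows "\<bar>signed_integral \<mu> f\<bar> \<le> sup_norm f * tv_norm \<mu>"
proof -
  have bound: "\<bar>\<integral>t. f t \<partial>M\<bar> \<le> sup_norm f * measure M UNIV"
    if "finite_measure M" "integrable M f" "space M = UNIV" for M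
  proof -
    interpret finite_measure M by fact
    have "\<bar>\<integral>t. f t \<partial>M\<bar> \<le> (\<integral>t. \<bar>f t\<bar> \<partial>M)" by (rule integral_abs_bound)
    also have "\<dots> \<le> (\<integral>t. sup_norm f \<partial>M)"
      using that(2) abs_le_sup_norm[OF f] by (intro integral_mono) auto
    finally show ?thesis using that(3) by (simp add: mult.commute)
  qed
  show ?thesis
    using bound[OF finite_positive_part[OF \<mu>] C0_integrable_positive_part[OF \<mu> f]]
      bound[OF finite_negative_part[OF \<mu>] C0_integrable_negative_part[OF \<mu> f]]
    unfolding signed_integral_def tv_norm_eq[OF \<mu>] by (simp add: algebra_simps)
qed

lemma borel_norming_points:
  assumes "g \<in> C0" shows "norming_points g \<in> sets borel"
proof -
  have "g \<in> borel_measurable borel" using assms by (rule C0_measurable)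
  then show ?thesis unfolding norming_points_def by measurable
qed

text \<open>
  Integrating \<open>sup_norm g - g\<close> against the positive part and \<open>sup_norm g + g\<close> against the negative
  part gives two nonnegative numbers with sum \<open>sup_norm g * tv_norm \<mu> - signed_integral \<mu> g = 0\<close>.
  So both integrands vanish almost everywhere, and each of them vanishes only at norming points.
\<close>

lemma variation_outside_norming_points:
  assumes \<mu>: "signed_borel_measure \<mu>" and g: "g \<in> C0"
    and eq: "signed_integral \<mu> g = sup_norm g * tv_norm \<mu>"
  shows "variation \<mu> (- norming_points g) = 0"
proof -
  interpret pos: finite_measure "positive_part \<mu>" using \<mu> by (rule finite_positive_part)
  interpret neg: finite_measure "negative_part \<mu>" using \<mu> by (rule finite_negative_part)
  note int = C0_integrable_positive_part[OF \<mu> g] C0_integrable_negative_part[OF \<mu> g]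
  let ?s = "sup_norm g"
  have ge: "0 \<le> ?s - g t" "0 \<le> ?s + g t" for t
    using abs_le_sup_norm[OF g, of t] by auto
  have N: "- norming_points g \<in> sets borel" using borel_norming_points[OF g] by auto
  have "(\<integral>t. ?s - g t \<partial>positive_part \<mu>) + (\<integral>t. ?s + g t \<partial>negative_part \<mu>) =
      ?s * tv_norm \<mu> - signed_integral \<mu> g"
    using int by (simp add: tv_norm_eq[OF \<mu>] signed_integral_def algebra_simps)
  also have "\<dots> = 0" using eq by simp
  finally have "(\<integral>t. ?s - g t \<partial>positive_part \<mu>) + (\<integral>t. ?s + g t \<partial>negative_part \<mu>) = 0" .
  moreover have "0 \<le> (\<integral>t. ?s - g t \<partial>positive_part \<mu>)" "0 \<le> (\<integral>t. ?s + g t \<partial>negative_part \<mu>)"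
    using ge by (auto intro: integral_nonneg_AE)
  ultimately have "(\<integral>t. ?s - g t \<partial>positive_part \<mu>) = 0" "(\<integral>t. ?s + g t \<partial>negative_part \<mu>) = 0"
    by linarith+
  then have "AE t in positive_part \<mu>. ?s - g t = 0" and "AE t in negative_part \<mu>. ?s + g t = 0"
    using integral_nonneg_eq_0_iff_AE[of "positive_part \<mu>" "\<lambda>t. ?s - g t"]
      integral_nonneg_eq_0_iff_AE[of "negative_part \<mu>" "\<lambda>t. ?s + g t"] ge int by auto
  moreover have "?s - g t = 0 \<Longrightarrow> t \<in> norming_points g" "?s + g t = 0 \<Longrightarrow> t \<in> norming_points g" for t
    using sup_norm_nonneg[OF g] by (auto simp: norming_points_def)
  ultimately have "AE t in positive_part \<mu>. t \<in> norming_points g"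
    and "AE t in negative_part \<mu>. t \<in> norming_points g"
    by (auto elim: eventually_mono)
  then have "emeasure (positive_part \<mu>) (- norming_points g) = 0"
    and "emeasure (negative_part \<mu>) (- norming_points g) = 0"
    using AE_iff_measurable[of "- norming_points g" "positive_part \<mu>" "\<lambda>t. t \<in> norming_points g"]
      AE_iff_measurable[of "- norming_points g" "negative_part \<mu>" "\<lambda>t. t \<in> norming_points g"] N
    by auto
  then show ?thesis using variation_eq_emeasure[OF \<mu> N] by simp
qed

lemma variation_mono:
  assumes "signed_borel_measure \<mu>" "A \<in> sets borel" "B \<in> sets borel" "A \<subseteq> B"
  shows "variation \<mu> A \<le> variation \<mu> B"
  using assms by (simp add: variation_eq_emeasure add_mono emeasure_mono)

lemma abs_le_variation:
  assumes "signed_borel_measure \<mu>" "A \<in> sets borel"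
  shows "ennreal \<bar>\<mu> A\<bar> \<le> variation \<mu> A"
  unfolding variation_eq_measure[OF assms] signed_measure_eq_diff[OF assms]
  by (intro ennreal_leI) (simp add: abs_le_iff)

lemma null_subset_of_variation_null:
  assumes "signed_borel_measure \<mu>" "variation \<mu> A = 0" "A \<in> sets borel" "B \<in> sets borel" "B \<subseteq> A"
  shows "\<mu> B = 0"
proof -
  have "ennreal \<bar>\<mu> B\<bar> \<le> variation \<mu> B" using assms by (intro abs_le_variation)
  also have "\<dots> \<le> variation \<mu> A" using assms by (intro variation_mono)
  finally show ?thesis using assms(2) by (simp add: ennreal_eq_0_iff)
qed

lemma signed_integral_concentrated:
  fixes \<mu> :: "'b::t2_space set \<Rightarrow> real"
  assumes \<mu>: "signed_borel_measure \<mu>" and N: "finite N" "variation \<mu> (- N) = 0"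
    and f: "f \<in> borel_measurable borel"
  shows "signed_integral \<mu> f = (\<Sum>t\<in>N. f t * \<mu> {t})"
proof -
  have N_meas: "- N \<in> sets borel" using N(1) by (intro borel_open open_Compl finite_imp_closed)
  have eq: "(\<integral>t. f t \<partial>M) = (\<Sum>t\<in>N. f t * measure M {t})"
    if "finite_measure M" "sets M = sets borel" "emeasure M (- N) = 0" for M
  proof -
    interpret finite_measure M by fact
    have sp: "space M = UNIV" using sets_eq_imp_space_eq[OF that(2)] by simp
    have "AE t in M. t \<in> N"
      using that N_meas sp by (subst AE_iff_measurable[of "- N"]) auto
    then have "AE s in M. f s = (\<Sum>t\<in>N. f t * indicat_real {t} s)"
    proof eventually_elim
      case (elim s)
      have "(\<Sum>t\<in>N. f t * indicat_real {t} s) = (\<Sum>t\<in>N. if t = s then f s else 0)"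
        by (intro sum.cong) (auto simp: indicator_def)
      then show ?case using elim N(1) by simp
    qed
    moreover have "f \<in> borel_measurable M"
      using f that(2) by (simp cong: measurable_cong_sets)
    moreover have sing: "{t} \<in> sets M" for t using that(2) by simp
    ultimately have "(\<integral>s. f s \<partial>M) = (\<integral>s. (\<Sum>t\<in>N. f t * indicat_real {t} s) \<partial>M)"
      by (intro integral_cong_AE) auto
    also have "\<dots> = (\<Sum>t\<in>N. \<integral>s. f t * indicat_real {t} s \<partial>M)"
      using sing by (intro Bochner_Integration.integral_sum integrable_mult_right
          integrable_real_indicator) (auto simp: emeasure_eq_measure)
    also have "\<dots> = (\<Sum>t\<in>N. f t * measure M {t})"
      using sp by simp
    finally show ?thesis .
  qed
  have "emeasure (positive_part \<mu>) (- N) = 0" "emeasure (negative_part \<mu>) (- N) = 0"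
    using N(2) variation_eq_emeasure[OF \<mu> N_meas] by auto
  then show ?thesis
    using signed_measure_eq_diff[OF \<mu>] finite_positive_part[OF \<mu>] finite_negative_part[OF \<mu>]
    by (simp add: signed_integral_def eq sum_subtractf[symmetric] right_diff_distrib)
qed

section \<open>Regular measures are determined by their integrals\<close>

text \<open>
  Complete regularity separates \<open>C\<close> from the complement of \<open>U \<inter> V\<close>, where \<open>V\<close> is a neighbourhood of
  \<open>C\<close> inside a compact set; the compact set is what puts the separating function into \<open>C0\<close>.
\<close>

lemma Urysohn_C0:
  fixes C U :: "'b::t2_space set"
  assumes lc: "locally_compact_space (euclidean :: 'b topology)"
    and "compact C" "open U" "C \<subseteq> U"
  obtains h where "h \<in> C0" "\<And>t. 0 \<le> h t \<and> h t \<le> 1" "\<And>t. t \<in> C \<Longrightarrow> h t = 1"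
    "\<And>t. t \<notin> U \<Longrightarrow> h t = 0"
proof -
  have H: "Hausdorff_space (euclidean :: 'b topology)"
    using hausdorff by (auto simp: Hausdorff_space_def disjnt_def)
  have "\<forall>K. compactin (euclidean :: 'b topology) K \<longrightarrow>
      (\<exists>V L. openin euclidean V \<and> compactin euclidean L \<and> closedin euclidean L \<and> K \<subseteq> V \<and> V \<subseteq> L)"
    using locally_compact_space_compact_closed_compact[of "euclidean :: 'b topology"] lc H by blast
  then obtain V L where V: "open V" "compact L" "C \<subseteq> V" "V \<subseteq> L"
    using \<open>compact C\<close> by (metis compactin_euclidean_iff open_openin)
  have "completely_regular_space (euclidean :: 'b topology)"
    using locally_compact_regular_imp_completely_regular_space lc H by blast
  moreover have "closedin euclidean (- (U \<inter> V))"
    using \<open>open U\<close> \<open>open V\<close> by auto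
  moreover have "disjnt C (- (U \<inter> V))"
    using \<open>C \<subseteq> U\<close> \<open>C \<subseteq> V\<close> by (auto simp: disjnt_def)
  moreover have "compactin euclidean C" using \<open>compact C\<close> by simp
  ultimately obtain h where h: "continuous_map euclidean (top_of_set {0..1::real}) h"
    "h ` (- (U \<inter> V)) \<subseteq> {0}" "h ` C \<subseteq> {1}"
    using Urysohn_completely_regular_compact_closed[of 0 1 "euclidean :: 'b topology" C "- (U \<inter> V)"]
    by auto
  have cont: "continuous_on UNIV h" and range: "h t \<in> {0..1}" for t
    using h(1) by (auto simp: continuous_map_in_subtopology)
  have "compact {t. \<epsilon> \<le> \<bar>h t\<bar>}" if "\<epsilon> > 0" for \<epsilon>
  proof -
    have "closed {t. \<epsilon> \<le> \<bar>h t\<bar>}"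
      by (intro closed_Collect_le continuous_intros cont)
    moreover have "{t. \<epsilon> \<le> \<bar>h t\<bar>} \<subseteq> L"
    proof
      fix t assume "t \<in> {t. \<epsilon> \<le> \<bar>h t\<bar>}"
      then have "h t \<noteq> 0" using that by auto
      then have "t \<in> V" using h(2) by auto
      then show "t \<in> L" using V(4) by auto
    qed
    ultimately show ?thesis
      using V(2) by (auto intro: compact_closed_subset)
  qed
  then have "h \<in> C0" using cont by (simp add: C0_def)
  then show thesis
  proof (rule that)
    show "0 \<le> h t \<and> h t \<le> 1" for t using range[of t] by simp
    show "h t = 1" if "t \<in> C" for t using h(3) that by auto
    show "h t = 0" if "t \<notin> U" for t using h(2) that by auto
  qed
qed

text \<open>
  For a positive measure the integral of \<open>h\<close> lies between the measures of \<open>C\<close> and \<open>U\<close>. Applied to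
  both Jordan parts this bounds the error by the variation of \<open>U - C\<close>.
\<close>

lemma signed_integral_near_compact:
  assumes \<mu>: "signed_borel_measure \<mu>" and h: "h \<in> C0" "\<And>t. 0 \<le> h t \<and> h t \<le> 1"
    and C: "C \<in> sets borel" "\<And>t. t \<in> C \<Longrightarrow> h t = 1"
    and U: "U \<in> sets borel" "\<And>t. t \<notin> U \<Longrightarrow> h t = 0"
    and e: "variation \<mu> U \<le> variation \<mu> C + ennreal \<epsilon>" "0 \<le> \<epsilon>"
  shows "\<bar>signed_integral \<mu> h - \<mu> C\<bar> \<le> \<epsilon>"
proof -
  have bounds: "measure M C \<le> (\<integral>t. h t \<partial>M)" "(\<integral>t. h t \<partial>M) \<le> measure M U"
    if "finite_measure M" "sets M = sets borel" "integrable M h" for M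
  proof -
    interpret finite_measure M by fact
    have sp: "space M = UNIV" using sets_eq_imp_space_eq[OF that(2)] by simp
    have "(\<integral>t. indicat_real C t \<partial>M) \<le> (\<integral>t. h t \<partial>M)"
      using that C h
      by (intro integral_mono integrable_real_indicator)
        (auto simp: emeasure_eq_measure split: split_indicator)
    then show "measure M C \<le> (\<integral>t. h t \<partial>M)" using sp by simp
    have "(\<integral>t. h t \<partial>M) \<le> (\<integral>t. indicat_real U t \<partial>M)"
      using that U h
      by (intro integral_mono integrable_real_indicator)
        (auto simp: emeasure_eq_measure split: split_indicator)
    then show "(\<integral>t. h t \<partial>M) \<le> measure M U" using sp by simp
  qed
  have "measure (positive_part \<mu>) U + measure (negative_part \<mu>) U
      \<le> measure (positive_part \<mu>) C + measure (negative_part \<mu>) C + \<epsilon>"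
    using e unfolding variation_eq_measure[OF \<mu> U(1)] variation_eq_measure[OF \<mu> C(1)]
    by (subst (asm) ennreal_plus[symmetric]) (simp_all del: ennreal_plus)
  moreover note
    bounds[OF finite_positive_part[OF \<mu>] sets_positive_part C0_integrable_positive_part[OF \<mu> h(1)]]
    bounds[OF finite_negative_part[OF \<mu>] sets_negative_part C0_integrable_negative_part[OF \<mu> h(1)]]
  ultimately show ?thesis
    unfolding signed_integral_def signed_measure_eq_diff[OF \<mu> C(1)] by linarith
qed

lemma regular_measures_signed: "\<mu> \<in> regular_measures \<Longrightarrow> signed_borel_measure \<mu>"
  by (simp add: regular_measures_def)

lemma variation_finite:
  assumes "signed_borel_measure \<mu>" "A \<in> sets borel"
  shows "variation \<mu> A < \<infinity>"
  using variation_eq_measure[OF assms] by (simp del: ennreal_plus)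

lemma outer_regular:
  assumes "\<mu> \<in> regular_measures" "A \<in> sets borel" "0 < \<epsilon>"
  obtains U where "open U" "A \<subseteq> U" "variation \<mu> U \<le> variation \<mu> A + ennreal \<epsilon>"
proof -
  obtain r where "variation \<mu> A = ennreal r" "0 \<le> r"
    using variation_eq_measure[OF regular_measures_signed[OF assms(1)] assms(2)]
    by (metis add_nonneg_nonneg measure_nonneg)
  then have "variation \<mu> A < variation \<mu> A + ennreal \<epsilon>"
    using assms(3) by (simp add: ennreal_less_iff flip: ennreal_plus)
  moreover have "variation \<mu> A = (INF U \<in> {U. open U \<and> A \<subseteq> U}. variation \<mu> U)"
    using assms(1,2) unfolding regular_measures_def by blast
  ultimately have "(INF U \<in> {U. open U \<and> A \<subseteq> U}. variation \<mu> U) < variation \<mu> A + ennreal \<epsilon>"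
    by simp
  then show thesis
    using that by (auto simp: INF_less_iff intro: less_imp_le)
qed

lemma inner_regular:
  fixes \<mu> :: "'b::t2_space set \<Rightarrow> real"
  assumes "\<mu> \<in> regular_measures" "A \<in> sets borel" "0 < \<epsilon>"
  obtains C where "compact C" "C \<subseteq> A" "variation \<mu> A \<le> variation \<mu> C + ennreal \<epsilon>"
proof (cases "variation \<mu> A = 0")
  case True
  then show ?thesis using that[of "{}"] by simp
next
  case False
  let ?v = "variation \<mu> A"
  have fin: "?v < \<infinity>" using assms by (intro variation_finite regular_measures_signed)
  have "?v - ennreal \<epsilon> < ?v"
    using False fin assms(3) by (intro ennreal_between) (auto simp: zero_less_iff_neq_zero)
  also have "?v = (SUP C \<in> {C. compact C \<and> C \<in> sets borel \<and> C \<subseteq> A}. variation \<mu> C)"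
    using assms unfolding regular_measures_def by blast
  finally obtain C where C: "compact C" "C \<subseteq> A" "?v - ennreal \<epsilon> < variation \<mu> C"
    by (auto simp: less_SUP_iff)
  have "?v \<le> variation \<mu> C + ennreal \<epsilon>"
    using less_imp_le[OF C(3)] by (auto simp: ennreal_minus_le_iff add.commute)
  with C(1,2) show ?thesis by (rule that)
qed

lemma abs_diff_le_variation:
  assumes \<mu>: "signed_borel_measure \<mu>" and AC: "A \<in> sets borel" "C \<in> sets borel" "C \<subseteq> A"
    and e: "variation \<mu> A \<le> variation \<mu> C + ennreal \<epsilon>" "0 \<le> \<epsilon>"
  shows "\<bar>\<mu> A - \<mu> C\<bar> \<le> \<epsilon>"
proof -
  have "measure (positive_part \<mu>) A + measure (negative_part \<mu>) A
      \<le> measure (positive_part \<mu>) C + measure (negative_part \<mu>) C + \<epsilon>"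
    using e unfolding variation_eq_measure[OF \<mu> AC(1)] variation_eq_measure[OF \<mu> AC(2)]
    by (subst (asm) ennreal_plus[symmetric]) (simp_all del: ennreal_plus)
  moreover have "measure (positive_part \<mu>) C \<le> measure (positive_part \<mu>) A"
    using AC by (intro finite_measure.finite_measure_mono finite_positive_part \<mu>) auto
  moreover have "measure (negative_part \<mu>) C \<le> measure (negative_part \<mu>) A"
    using AC by (intro finite_measure.finite_measure_mono finite_negative_part \<mu>) auto
  ultimately show ?thesis
    unfolding signed_measure_eq_diff[OF \<mu> AC(1)] signed_measure_eq_diff[OF \<mu> AC(2)] by linarith
qed

text \<open>
  The uniqueness half of the Riesz representation theorem. On a compact set a measure is, by outer
  regularity, approximated by integrals of Urysohn functions, which the two measures share; inner
  regularity carries the equality over to all Borel sets. The functions and the compact sets have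
  to serve both measures at once, hence the intersection of the two open sets and the union of the
  two compact sets.
\<close>

theorem regular_measures_eqI:
  fixes \<mu> \<nu> :: "'b::t2_space set \<Rightarrow> real"
  assumes lc: "locally_compact_space (euclidean :: 'b topology)"
    and \<mu>: "\<mu> \<in> regular_measures" and \<nu>: "\<nu> \<in> regular_measures"
    and eq: "\<And>h. h \<in> C0 \<Longrightarrow> signed_integral \<mu> h = signed_integral \<nu> h"
  shows "\<mu> = \<nu>"
proof
  note s = regular_measures_signed[OF \<mu>] regular_measures_signed[OF \<nu>]
  have compact_eq: "\<mu> C = \<nu> C" if C: "compact C" for C
  proof (rule ccontr)
    assume "\<mu> C \<noteq> \<nu> C"
    define \<epsilon> where "\<epsilon> = \<bar>\<mu> C - \<nu> C\<bar> / 3"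
    have \<epsilon>: "0 < \<epsilon>" using \<open>\<mu> C \<noteq> \<nu> C\<close> by (simp add: \<epsilon>_def)
    have C_meas: "C \<in> sets borel" using C by (rule borel_compact)
    obtain U where U: "open U" "C \<subseteq> U" "variation \<mu> U \<le> variation \<mu> C + ennreal \<epsilon>"
      using outer_regular[OF \<mu> C_meas \<epsilon>] .
    obtain V where V: "open V" "C \<subseteq> V" "variation \<nu> V \<le> variation \<nu> C + ennreal \<epsilon>"
      using outer_regular[OF \<nu> C_meas \<epsilon>] .
    obtain h where h: "h \<in> C0" "\<And>t. 0 \<le> h t \<and> h t \<le> 1" "\<And>t. t \<in> C \<Longrightarrow> h t = 1"
      "\<And>t. t \<notin> U \<inter> V \<Longrightarrow> h t = 0"
      using Urysohn_C0[OF lc C, of "U \<inter> V"] U V by auto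
    have "\<bar>signed_integral \<mu> h - \<mu> C\<bar> \<le> \<epsilon>"
      using h U(1) \<epsilon> by (intro signed_integral_near_compact[OF s(1) h(1,2) C_meas h(3) _ _ U(3)]) auto
    moreover have "\<bar>signed_integral \<nu> h - \<nu> C\<bar> \<le> \<epsilon>"
      using h V(1) \<epsilon> by (intro signed_integral_near_compact[OF s(2) h(1,2) C_meas h(3) _ _ V(3)]) auto
    ultimately have "\<bar>\<mu> C - \<nu> C\<bar> \<le> 2 * \<epsilon>"
      using eq[OF h(1)] by linarith
    then show False using \<epsilon> by (simp add: \<epsilon>_def)
  qed
  fix A show "\<mu> A = \<nu> A"
  proof (cases "A \<in> sets borel")
    case False
    then show ?thesis using s by (simp add: signed_measure_nonborel)
  next
    case A: True
    show ?thesis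
    proof (rule ccontr)
      assume "\<mu> A \<noteq> \<nu> A"
      define \<epsilon> where "\<epsilon> = \<bar>\<mu> A - \<nu> A\<bar> / 3"
      have \<epsilon>: "0 < \<epsilon>" using \<open>\<mu> A \<noteq> \<nu> A\<close> by (simp add: \<epsilon>_def)
      obtain C where C: "compact C" "C \<subseteq> A" "variation \<mu> A \<le> variation \<mu> C + ennreal \<epsilon>"
        using inner_regular[OF \<mu> A \<epsilon>] .
      obtain D where D: "compact D" "D \<subseteq> A" "variation \<nu> A \<le> variation \<nu> D + ennreal \<epsilon>"
        using inner_regular[OF \<nu> A \<epsilon>] .
      have CD: "compact (C \<union> D)" using C D by (intro compact_Un)
      note meas = borel_compact[OF C(1)] borel_compact[OF D(1)] borel_compact[OF CD]
      have "variation \<mu> A \<le> variation \<mu> (C \<union> D) + ennreal \<epsilon>"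
        using C(3) variation_mono[OF s(1) meas(1,3)] by (auto intro: order_trans add_right_mono)
      then have "\<bar>\<mu> A - \<mu> (C \<union> D)\<bar> \<le> \<epsilon>"
        using C(2) D(2) meas \<epsilon> by (intro abs_diff_le_variation s A) auto
      moreover have "variation \<nu> A \<le> variation \<nu> (C \<union> D) + ennreal \<epsilon>"
        using D(3) variation_mono[OF s(2) meas(2,3)] by (auto intro: order_trans add_right_mono)
      then have "\<bar>\<nu> A - \<nu> (C \<union> D)\<bar> \<le> \<epsilon>"
        using C(2) D(2) meas \<epsilon> by (intro abs_diff_le_variation s A) auto
      ultimately have "\<bar>\<mu> A - \<nu> A\<bar> \<le> 2 * \<epsilon>"
        using compact_eq[OF CD] by linarith
      then show False using \<epsilon> by (simp add: \<epsilon>_def)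
    qed
  qed
qed

lemma signed_integral_eq_on_span:
  fixes B :: "('b::t2_space \<Rightarrow> real) set"
  assumes s: "signed_borel_measure \<mu>" "signed_borel_measure \<nu>"
    and "B \<subseteq> C0" "\<And>f. f \<in> B \<Longrightarrow> signed_integral \<mu> f = signed_integral \<nu> f" "g \<in> span B"
  shows "signed_integral \<mu> g = signed_integral \<nu> g"
proof -
  let ?S = "{g \<in> C0. signed_integral \<mu> g = signed_integral \<nu> g}"
  have "real_vector.subspace ?S"
    using real_vector.subspace_0[OF subspace_C0] real_vector.subspace_add[OF subspace_C0]
      real_vector.subspace_scale[OF subspace_C0]
    by (auto intro!: real_vector.subspaceI simp: signed_integral_0 signed_integral_add s
        signed_integral_scaleR)
  moreover have "B \<subseteq> ?S" using assms by auto
  ultimately have "span B \<subseteq> ?S" by (rule real_vector.span_minimal[rotated])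
  then show ?thesis using assms by auto
qed

lemma span_subset_C0: "B \<subseteq> C0 \<Longrightarrow> span B \<subseteq> (C0 :: ('b::t2_space \<Rightarrow> real) set)"
  by (rule real_vector.span_minimal[OF _ subspace_C0])

locale dense_kernel =
  fixes K :: "'a \<Rightarrow> 'b::t2_space \<Rightarrow> real"
  assumes locally_compact: "locally_compact_space (euclidean :: 'b topology)"
    and kernel_C0: "\<And>u. K u \<in> C0"
    and dense_span: "\<And>h \<epsilon>. h \<in> C0 \<Longrightarrow> \<epsilon> > 0 \<Longrightarrow> \<exists>g \<in> span (range K). sup_norm (h - g) < \<epsilon>"
begin

text \<open>
  Integration of \<open>C0\<close> functions is continuous for the supremum norm, so it is determined by its
  values on a dense span.
\<close>

lemma kernel_integral_inj:
  assumes \<mu>: "\<mu> \<in> regular_measures" and \<nu>: "\<nu> \<in> regular_measures"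
    and eq: "kernel_integral K \<mu> = kernel_integral K \<nu>"
  shows "\<mu> = \<nu>"
proof (rule regular_measures_eqI[OF locally_compact \<mu> \<nu>])
  note s = regular_measures_signed[OF \<mu>] regular_measures_signed[OF \<nu>]
  have sub: "range K \<subseteq> C0" using kernel_C0 by (rule image_subsetI)
  have on_range: "signed_integral \<mu> f = signed_integral \<nu> f" if f: "f \<in> range K" for f
  proof -
    obtain u where "f = K u" using f by (rule rangeE)
    then show ?thesis using fun_cong[OF eq, of u] by (simp add: kernel_integral_def)
  qed
  fix h :: "'b \<Rightarrow> real" assume h: "h \<in> C0"
  let ?d = "\<bar>signed_integral \<mu> h - signed_integral \<nu> h\<bar>" and ?c = "tv_norm \<mu> + tv_norm \<nu>"
  have bound: "?d \<le> \<epsilon> * ?c" if \<epsilon>: "\<epsilon> > 0" for \<epsilon>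
  proof -
    obtain g where g: "g \<in> span (range K)" "sup_norm (h - g) < \<epsilon>"
      using dense_span[OF h \<epsilon>] by auto
    have gS: "g \<in> C0" "signed_integral \<mu> g = signed_integral \<nu> g"
      using span_subset_C0[OF sub] g(1) signed_integral_eq_on_span[OF s sub on_range g(1)]
      by blast+
    have hg: "h - g \<in> C0" using subspace_C0 h gS(1) by (rule real_vector.subspace_diff)
    have split: "signed_integral \<kappa> h = signed_integral \<kappa> (h - g) + signed_integral \<kappa> g"
      if "signed_borel_measure \<kappa>" for \<kappa>
      using signed_integral_add[OF that hg gS(1)] by simp
    have "?d \<le> sup_norm (h - g) * ?c"
      using split[OF s(1)] split[OF s(2)] gS(2) signed_integral_bound[OF s(1) hg]
        signed_integral_bound[OF s(2) hg] by (simp add: distrib_left)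
    also have "\<dots> \<le> \<epsilon> * ?c"
      using g(2) by (intro mult_right_mono) (auto simp: tv_norm_def)
    finally show ?thesis .
  qed
  have "?d = 0"
  proof (rule ccontr)
    assume "?d \<noteq> 0"
    then have d: "0 < ?d" by simp
    have c: "0 \<le> ?c" by (simp add: tv_norm_def)
    \<comment> \<open>The summand 1 keeps the quotient defined when both measures are zero.\<close>
    have "?d \<le> ?d / (?c + 1) * ?c" using d c by (intro bound) auto
    also have "\<dots> < ?d" using d c by (simp add: field_simps)
    finally show False by simp
  qed
  then show "signed_integral \<mu> h = signed_integral \<nu> h" by simp
qed

text \<open>
  Injectivity is what makes the definite description in \<open>rkbs_norm\<close> denote the measure at hand.
\<close>

lemma rkbs_norm_kernel_integral:
  assumes "\<mu> \<in> regular_measures"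
  shows "rkbs_norm K (kernel_integral K \<mu>) = tv_norm \<mu>"
proof -
  have "(THE \<nu>. \<nu> \<in> regular_measures \<and> kernel_integral K \<mu> = kernel_integral K \<nu>) = \<mu>"
    using assms kernel_integral_inj by (intro the_equality) auto
  then show ?thesis by (simp add: rkbs_norm_def)
qed

end

section \<open>Finite combinations of point masses\<close>

text \<open>
  The measure \<open>\<Sum>t\<in>N. a t \<delta>\<^sub>t\<close>. It is cut off outside the Borel sets because
  \<open>signed_borel_measure\<close> demands the value zero there.
\<close>

definition point_masses :: "'b::t2_space set \<Rightarrow> ('b \<Rightarrow> real) \<Rightarrow> 'b set \<Rightarrow> real"
  where "point_masses N a A = (if A \<in> sets borel then \<Sum>t\<in>A \<inter> N. a t else 0)"

lemma point_masses_signed: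
  assumes "finite N" shows "signed_borel_measure (point_masses N a)"
  unfolding signed_borel_measure_def
proof (intro conjI allI impI)
  fix A :: "nat \<Rightarrow> 'a set"
  assume A: "range A \<subseteq> sets borel" "disjoint_family A"
  have eq: "point_masses N a B = (\<Sum>t\<in>N. a t * indicator B t)" if "B \<in> sets borel" for B
  proof -
    have "(\<Sum>t\<in>B \<inter> N. a t) = (\<Sum>t\<in>N. a t * indicator B t)"
      using assms by (intro sum.mono_neutral_cong_left) (auto simp: indicator_def)
    then show ?thesis using that by (simp add: point_masses_def)
  qed
  have "(\<lambda>i. \<Sum>t\<in>N. a t * indicator (A i) t) sums (\<Sum>t\<in>N. a t * indicator (\<Union>i. A i) t)"
  proof (rule sums_sum)
    fix t
    show "(\<lambda>i. a t * indicator (A i) t) sums (a t * indicator (\<Union>i. A i) t)"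
    proof (cases "t \<in> (\<Union>i. A i)")
      case True
      then obtain j where j: "t \<in> A j" by auto
      then have "t \<notin> A i" if "i \<noteq> j" for i
        using A(2) that by (auto simp: disjoint_family_on_def)
      then have "(\<lambda>i. a t * indicator (A i) t) = (\<lambda>i. if i = j then a t else 0)"
        using j by (auto simp: fun_eq_iff indicator_def)
      then show ?thesis using True sums_single[of j "\<lambda>_. a t"] by simp
    next
      case False
      then have "(\<lambda>i. a t * indicator (A i) t) = (\<lambda>i. 0)"
        by (auto simp: fun_eq_iff indicator_def)
      then show ?thesis using False by simp
    qed
  qed
  moreover have "A i \<in> sets borel" for i using A(1) by auto
  moreover have "(\<Union>i. A i) \<in> sets borel" using A(1) by auto
  ultimately show "(\<lambda>i. point_masses N a (A i)) sums point_masses N a (\<Union>i. A i)"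
    by (simp add: eq)
qed (auto simp: point_masses_def)

lemma point_masses_singleton: "t \<in> N \<Longrightarrow> point_masses N a {t} = a t"
  by (simp add: point_masses_def)

lemma variation_point_masses:
  assumes "finite N" "A \<in> sets borel"
  shows "variation (point_masses N a) A = ennreal (\<Sum>t\<in>A \<inter> N. \<bar>a t\<bar>)"
proof -
  have "variation (point_masses N a) A = ennreal (\<Sum>t\<in>A \<inter> N. \<bar>point_masses N a {t}\<bar>)"
    using assms
    by (intro variation_concentrated point_masses_signed) (auto simp: point_masses_def)
  also have "(\<Sum>t\<in>A \<inter> N. \<bar>point_masses N a {t}\<bar>) = (\<Sum>t\<in>A \<inter> N. \<bar>a t\<bar>)"
    by (intro sum.cong) (auto simp: point_masses_singleton)
  finally show ?thesis .
qed

text \<open>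
  All variation is carried by the finite set \<open>N\<close>, so both approximations are attained: from inside
  by the compact set \<open>A \<inter> N\<close>, from outside by the open set \<open>- (N - A)\<close>.
\<close>

lemma point_masses_regular:
  assumes "finite N" shows "point_masses N a \<in> regular_measures"
proof -
  let ?v = "variation (point_masses N a)"
  have mono: "?v A \<le> ?v B" if "A \<in> sets borel" "B \<in> sets borel" "A \<subseteq> B" for A B
    using that assms by (intro variation_mono point_masses_signed)
  have "?v A = (SUP C \<in> {C. compact C \<and> C \<in> sets borel \<and> C \<subseteq> A}. ?v C) \<and>
      ?v A = (INF U \<in> {U. open U \<and> A \<subseteq> U}. ?v U)" if A: "A \<in> sets borel" for A
  proof (intro conjI antisym)
    have AN: "compact (A \<inter> N)" using assms by (intro finite_imp_compact) simp
    have "?v A = ?v (A \<inter> N)"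
      using A borel_compact[OF AN] assms by (simp add: variation_point_masses Int_assoc)
    also have "\<dots> \<le> (SUP C \<in> {C. compact C \<and> C \<in> sets borel \<and> C \<subseteq> A}. ?v C)"
      using AN borel_compact[OF AN] by (intro SUP_upper) auto
    finally show "?v A \<le> (SUP C \<in> {C. compact C \<and> C \<in> sets borel \<and> C \<subseteq> A}. ?v C)" .
    show "(SUP C \<in> {C. compact C \<and> C \<in> sets borel \<and> C \<subseteq> A}. ?v C) \<le> ?v A"
      using A mono by (intro SUP_least) auto
    show "?v A \<le> (INF U \<in> {U. open U \<and> A \<subseteq> U}. ?v U)"
      using A mono by (intro INF_greatest) auto
    have U: "open (- (N - A))"
      using assms by (intro open_Compl finite_imp_closed) simp
    have "(INF U \<in> {U. open U \<and> A \<subseteq> U}. ?v U) \<le> ?v (- (N - A))"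
      using U by (intro INF_lower) auto
    also have "- (N - A) \<inter> N = A \<inter> N" by auto
    then have "?v (- (N - A)) = ?v A"
      using A borel_open[OF U] assms by (simp add: variation_point_masses)
    finally show "(INF U \<in> {U. open U \<and> A \<subseteq> U}. ?v U) \<le> ?v A" .
  qed
  then show ?thesis
    using point_masses_signed[OF assms] unfolding regular_measures_def by blast
qed

lemma tv_norm_point_masses: "finite N \<Longrightarrow> tv_norm (point_masses N a) = (\<Sum>t\<in>N. \<bar>a t\<bar>)"
  by (simp add: tv_norm_def variation_point_masses sum_nonneg)

lemma signed_integral_point_masses:
  assumes "finite N" "f \<in> borel_measurable borel"
  shows "signed_integral (point_masses N a) f = (\<Sum>t\<in>N. f t * a t)"
proof -
  have "- N \<in> sets borel"
    using assms(1) by (intro borel_open open_Compl finite_imp_closed)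
  then have "variation (point_masses N a) (- N) = 0"
    using assms(1) by (simp add: variation_point_masses)
  then have "signed_integral (point_masses N a) f = (\<Sum>t\<in>N. f t * point_masses N a {t})"
    using assms by (intro signed_integral_concentrated point_masses_signed)
  also have "\<dots> = (\<Sum>t\<in>N. f t * a t)"
    by (intro sum.cong) (auto simp: point_masses_singleton)
  finally show ?thesis .
qed

lemma sum_fun_apply:
  fixes f :: "'i \<Rightarrow> 'a \<Rightarrow> 'b::comm_monoid_add"
  shows "(\<Sum>i\<in>I. f i) u = (\<Sum>i\<in>I. f i u)"
  by (induction I rule: infinite_finite_induct) (auto simp: zero_fun_def plus_fun_def)

lemma kernel_integral_point_masses:
  assumes "finite N" "\<And>u. K u \<in> C0"
  shows "kernel_integral K (point_masses N a) = (\<Sum>t\<in>N. a t *\<^sub>R (\<lambda>u. K u t))"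
  by (simp add: kernel_integral_def fun_eq_iff sum_fun_apply scaleR_fun_def mult.commute
      signed_integral_point_masses[OF assms(1) C0_measurable[OF assms(2)]])

section \<open>Minimal norm and the dual certificate\<close>

text \<open>
  Once the measure is known to live on the norming points, its norm and its integral of \<open>g\<close> are
  finite sums over them. The differences \<open>sup_norm g * \<bar>\<mu> {t}\<bar> - g t * \<mu> {t}\<close> are nonnegative and add
  up to zero, so each of them is zero: every atom has the sign of \<open>g\<close>.
\<close>

lemma norm_attaining_measure:
  fixes \<mu> :: "'b::t2_space set \<Rightarrow> real"
  assumes \<mu>: "signed_borel_measure \<mu>" and g: "g \<in> C0" and N: "finite (norming_points g)"
    and eq: "signed_integral \<mu> g = sup_norm g * tv_norm \<mu>"
  shows "f \<in> borel_measurable borel \<Longrightarrow>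
      signed_integral \<mu> f = (\<Sum>t\<in>norming_points g. f t * \<mu> {t})"
    and "tv_norm \<mu> = (\<Sum>t\<in>norming_points g. \<bar>\<mu> {t}\<bar>)"
    and "t \<in> norming_points g \<Longrightarrow> g t * \<mu> {t} = sup_norm g * \<bar>\<mu> {t}\<bar>"
proof -
  let ?N = "norming_points g"
  have null: "variation \<mu> (- ?N) = 0"
    using \<mu> g eq by (rule variation_outside_norming_points)
  have CN: "- ?N \<in> sets borel" using borel_norming_points[OF g] by auto
  show int: "signed_integral \<mu> f = (\<Sum>t\<in>?N. f t * \<mu> {t})" if "f \<in> borel_measurable borel" for f
    using \<mu> N null that by (rule signed_integral_concentrated)
  have "\<mu> B = 0" if "B \<in> sets borel" "B \<inter> ?N = {}" for B
    using that by (intro null_subset_of_variation_null[OF \<mu> null CN]) auto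
  then have "variation \<mu> UNIV = ennreal (\<Sum>t\<in>?N. \<bar>\<mu> {t}\<bar>)"
    using variation_concentrated[OF \<mu> N, of UNIV] by simp
  then show tv: "tv_norm \<mu> = (\<Sum>t\<in>?N. \<bar>\<mu> {t}\<bar>)"
    by (simp add: tv_norm_def sum_nonneg)
  have "(\<Sum>t\<in>?N. sup_norm g * \<bar>\<mu> {t}\<bar> - g t * \<mu> {t}) = 0"
    using eq int[OF C0_measurable[OF g]] tv by (simp add: sum_subtractf sum_distrib_left)
  moreover have "0 \<le> sup_norm g * \<bar>\<mu> {t}\<bar> - g t * \<mu> {t}" for t
  proof -
    have "g t * \<mu> {t} \<le> \<bar>g t\<bar> * \<bar>\<mu> {t}\<bar>" by (metis abs_ge_self abs_mult)
    also have "\<dots> \<le> sup_norm g * \<bar>\<mu> {t}\<bar>"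
      using abs_le_sup_norm[OF g] by (intro mult_right_mono) auto
    finally show ?thesis by simp
  qed
  ultimately have "\<forall>t\<in>?N. sup_norm g * \<bar>\<mu> {t}\<bar> - g t * \<mu> {t} = 0"
    using N by (subst (asm) sum_nonneg_eq_0_iff) auto
  then show "g t * \<mu> {t} = sup_norm g * \<bar>\<mu> {t}\<bar>" if "t \<in> ?N" for t
    using that by simp
qed

text \<open>
  The weights are indexed by the points of \<open>N\<close> and not by their images, so that \<open>F\<close> may identify
  points.
\<close>

lemma convex_hull_image_finite:
  fixes F :: "'i \<Rightarrow> 'v::real_vector"
  assumes "finite N" "v \<in> convex hull (F ` N)"
  shows "\<exists>w. (\<forall>t\<in>N. 0 \<le> w t) \<and> sum w N = 1 \<and> v = (\<Sum>t\<in>N. w t *\<^sub>R F t)"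
proof -
  let ?C = "{v. \<exists>w. (\<forall>t\<in>N. 0 \<le> w t) \<and> sum w N = 1 \<and> v = (\<Sum>t\<in>N. w t *\<^sub>R F t)}"
  have "F ` N \<subseteq> ?C"
  proof clarify
    fix s assume s: "s \<in> N"
    have "(\<Sum>t\<in>N. (if t = s then 1 else 0) *\<^sub>R F t) = F s"
      using assms(1) s by (simp add: if_distrib[of "\<lambda>c. c *\<^sub>R F _"] cong: if_cong)
    then show "\<exists>w. (\<forall>t\<in>N. 0 \<le> w t) \<and> sum w N = 1 \<and> F s = (\<Sum>t\<in>N. w t *\<^sub>R F t)"
      using assms(1) s by (intro exI[of _ "\<lambda>t. if t = s then 1 else 0"]) auto
  qed
  moreover have "convex ?C"
  proof (rule convexI, clarify)
    fix p q :: real and w w' :: "'i \<Rightarrow> real"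
    assume pq: "0 \<le> p" "0 \<le> q" "p + q = 1"
      and w: "\<forall>t\<in>N. 0 \<le> w t" "sum w N = 1" and w': "\<forall>t\<in>N. 0 \<le> w' t" "sum w' N = 1"
    let ?w = "\<lambda>t. p * w t + q * w' t"
    have "sum ?w N = 1"
      using w(2) w'(2) pq by (simp add: sum.distrib flip: sum_distrib_left)
    moreover have "p *\<^sub>R (\<Sum>t\<in>N. w t *\<^sub>R F t) + q *\<^sub>R (\<Sum>t\<in>N. w' t *\<^sub>R F t) = (\<Sum>t\<in>N. ?w t *\<^sub>R F t)"
      by (simp add: scaleR_sum_right sum.distrib scaleR_add_left)
    ultimately show "\<exists>v. (\<forall>t\<in>N. 0 \<le> v t) \<and> sum v N = 1 \<and>
        p *\<^sub>R (\<Sum>t\<in>N. w t *\<^sub>R F t) + q *\<^sub>R (\<Sum>t\<in>N. w' t *\<^sub>R F t) = (\<Sum>t\<in>N. v t *\<^sub>R F t)"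
      using w(1) w'(1) pq by (intro exI[of _ ?w]) auto
  qed
  ultimately have "convex hull (F ` N) \<subseteq> ?C" by (rule hull_minimal)
  then show ?thesis using assms(2) by auto
qed

context dense_kernel
begin

text \<open>
  The function \<open>g\<close> is a dual certificate. It is a combination of the \<open>K (x j)\<close>, so its integral is the
  same for all interpolating measures, and by \<open>\<nu>\<close> it equals \<open>(sup_norm g)\<^sup>2\<close>. Hence an interpolating
  measure has norm at least \<open>sup_norm g\<close>, and \<open>\<nu>\<close> shows that this bound is attained.
\<close>

lemma min_norm_interpolants_eq:
  assumes g: "g \<in> span ((\<lambda>j. K (x j)) ` {..<n})" "0 < sup_norm g"
    and \<nu>: "\<nu> \<in> regular_measures" "kernel_integral K \<nu> \<in> interpolants K n x y"
      "tv_norm \<nu> \<le> sup_norm g" "signed_integral \<nu> g = sup_norm g * sup_norm g"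
    and \<mu>: "\<mu> \<in> regular_measures"
  shows "kernel_integral K \<mu> \<in> min_norm_interpolants K n x y \<longleftrightarrow>
      kernel_integral K \<mu> \<in> interpolants K n x y \<and> tv_norm \<mu> = sup_norm g"
    and "kernel_integral K \<mu> \<in> interpolants K n x y \<Longrightarrow>
      signed_integral \<mu> g = sup_norm g * sup_norm g"
proof -
  let ?s = "sup_norm g"
  have sub: "(\<lambda>j. K (x j)) ` {..<n} \<subseteq> C0" using kernel_C0 by auto
  then have gC: "g \<in> C0" using g(1) span_subset_C0 by blast
  have int: "signed_integral \<kappa> g = ?s * ?s"
    if "\<kappa> \<in> regular_measures" "kernel_integral K \<kappa> \<in> interpolants K n x y" for \<kappa>
  proof -
    have "signed_integral \<kappa> f = signed_integral \<nu> f" if f: "f \<in> (\<lambda>j. K (x j)) ` {..<n}" for f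
    proof -
      obtain j where "j < n" "f = K (x j)" using f by auto
      moreover have "kernel_integral K \<kappa> (x j) = y j" "kernel_integral K \<nu> (x j) = y j"
        using \<open>kernel_integral K \<kappa> \<in> interpolants K n x y\<close> \<nu>(2) \<open>j < n\<close>
        by (auto simp: interpolants_def)
      ultimately show ?thesis by (simp add: kernel_integral_def)
    qed
    then have "signed_integral \<kappa> g = signed_integral \<nu> g"
      by (rule signed_integral_eq_on_span[OF regular_measures_signed[OF that(1)]
            regular_measures_signed[OF \<nu>(1)] sub _ g(1)])
    then show ?thesis using \<nu>(4) by simp
  qed
  show "kernel_integral K \<mu> \<in> interpolants K n x y \<Longrightarrow> signed_integral \<mu> g = ?s * ?s"
    using int \<mu> by simp
  have lower: "?s \<le> tv_norm \<kappa>"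
    if "\<kappa> \<in> regular_measures" "kernel_integral K \<kappa> \<in> interpolants K n x y" for \<kappa>
  proof -
    have "?s * ?s \<le> ?s * tv_norm \<kappa>"
      using int[OF that] signed_integral_bound[OF regular_measures_signed[OF that(1)] gC] by simp
    then show ?thesis using g(2) by simp
  qed
  have "(INF h \<in> interpolants K n x y. rkbs_norm K h) = ?s"
  proof (rule cInf_eq_minimum)
    have "rkbs_norm K (kernel_integral K \<nu>) = ?s"
      using rkbs_norm_kernel_integral[OF \<nu>(1)] lower[OF \<nu>(1,2)] \<nu>(3) by simp
    then show "?s \<in> rkbs_norm K ` interpolants K n x y"
      using imageI[OF \<nu>(2), of "rkbs_norm K"] by simp
  next
    fix r assume "r \<in> rkbs_norm K ` interpolants K n x y"
    then obtain h where h: "h \<in> interpolants K n x y" "r = rkbs_norm K h" by auto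
    then obtain \<kappa> where "\<kappa> \<in> regular_measures" "h = kernel_integral K \<kappa>"
      by (auto simp: interpolants_def rkbs_def)
    then show "?s \<le> r"
      using h lower[of \<kappa>] rkbs_norm_kernel_integral[of \<kappa>] by simp
  qed
  then show "kernel_integral K \<mu> \<in> min_norm_interpolants K n x y \<longleftrightarrow>
      kernel_integral K \<mu> \<in> interpolants K n x y \<and> tv_norm \<mu> = ?s"
    using rkbs_norm_kernel_integral[OF \<mu>] by (auto simp: min_norm_interpolants_def)
qed

end

section \<open>Independent columns and the rank of the kernel matrix\<close>

text \<open>
  The points of \<open>P\<close> label columns of the kernel matrix. The hypothesis is linear independence of
  this family of columns, which includes that no column occurs twice.
\<close>

lemma card_le_rank_kernel_matrix:
  fixes K :: "'a \<Rightarrow> 'b \<Rightarrow> real"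
  assumes N: "finite (norming_points g)" and P: "P \<subseteq> norming_points g"
    and indep: "\<And>b. (\<And>i. i < n \<Longrightarrow> (\<Sum>t\<in>P. b t * K (x i) t) = 0) \<Longrightarrow> \<forall>t\<in>P. b t = 0"
  shows "card P \<le> vec_space.rank n (kernel_matrix K n x g)"
proof -
  interpret vec_space "TYPE(real)" n .
  let ?N = "norming_points g" and ?A = "kernel_matrix K n x g"
  define c where "c t = vec n (\<lambda>i. K (x i) t)" for t
  have finP: "finite P" using N P by (rule rev_finite_subset)
  have A: "?A \<in> carrier_mat n (card ?N)" by (simp add: kernel_matrix_def)
  have "inj_on c P"
  proof (rule inj_onI, rule ccontr)
    fix s t assume st: "s \<in> P" "t \<in> P" "c s = c t" "s \<noteq> t"
    define b :: "'b \<Rightarrow> real" where "b r = (if r = s then 1 else if r = t then - 1 else 0)" for r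
    have "(\<Sum>r\<in>P. b r * K (x i) r) = 0" if "i < n" for i
    proof -
      have "K (x i) s = K (x i) t"
        using arg_cong[OF st(3), of "\<lambda>v. vec_index v i"] that by (simp add: c_def)
      moreover have "(\<Sum>r\<in>P. b r * K (x i) r) = (\<Sum>r\<in>{s, t}. b r * K (x i) r)"
        using st finP by (intro sum.mono_neutral_right) (auto simp: b_def)
      moreover have "\<dots> = K (x i) s - K (x i) t"
        using st(4) by (simp add: b_def)
      ultimately show ?thesis by simp
    qed
    then have "\<forall>r\<in>P. b r = 0" by (rule indep)
    then show False using st(1) by (auto simp: b_def)
  qed
  have cols: "c ` P \<subseteq> set (cols ?A)"
  proof clarify
    fix t assume "t \<in> P"
    then have "t \<in> ?N" using P by auto
    then have "t \<in> from_nat_into ?N ` {..<card ?N}"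
      using bij_betw_from_nat_into_finite[OF N] by (simp add: bij_betw_def)
    then obtain j where j: "j < card ?N" "from_nat_into ?N j = t" by auto
    have "c t = col ?A j"
      using j by (intro eq_vecI) (auto simp: c_def kernel_matrix_def)
    then show "c t \<in> set (cols ?A)"
      using j A by (auto simp: cols_def)
  qed
  have carr: "c ` P \<subseteq> carrier_vec n" by (auto simp: c_def)
  have "lin_indpt (c ` P)"
  proof (rule finite_lin_indpt2)
    show "finite (c ` P)" using finP by simp
    show "c ` P \<subseteq> carrier_vec n" by (rule carr)
    fix a :: "real vec \<Rightarrow> real" assume a: "lincomb a (c ` P) = 0\<^sub>v n"
    have "(\<Sum>t\<in>P. a (c t) * K (x i) t) = 0" if i: "i < n" for i
    proof -
      have "0 = vec_index (lincomb a (c ` P)) i" using a i by simp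
      also have "\<dots> = (\<Sum>v\<in>c ` P. a v * vec_index v i)"
        by (rule lincomb_index[OF i carr])
      also have "\<dots> = (\<Sum>t\<in>P. a (c t) * vec_index (c t) i)"
        by (subst sum.reindex[OF \<open>inj_on c P\<close>]) simp
      also have "\<dots> = (\<Sum>t\<in>P. a (c t) * K (x i) t)"
        using i by (simp add: c_def)
      finally show ?thesis by simp
    qed
    then have "\<forall>t\<in>P. a (c t) = 0" by (rule indep)
    then show "\<forall>v\<in>c ` P. a v = 0" by auto
  qed
  then have "card (c ` P) \<le> rank ?A"
    using rank_ge_card_indpt[OF A cols] by simp
  then show ?thesis using card_image[OF \<open>inj_on c P\<close>] by simp
qed

section \<open>Extreme minimal norm interpolants\<close>

text \<open>
  A point of the scaled convex hull is a combination of kernel sections with coefficients of total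
  size at most \<open>sup_norm g\<close> and with the signs of \<open>g\<close> at norming points, so the corresponding
  combination of point masses attains the norm of \<open>g\<close>.
\<close>

lemma certificate_measure:
  fixes K :: "'a \<Rightarrow> 'b::t2_space \<Rightarrow> real"
  assumes K: "\<And>u. K u \<in> C0" and g: "g \<in> C0" and N: "finite (norming_points g)"
    and f: "f \<in> (\<lambda>h. sup_norm g *\<^sub>R h) ` (convex hull (signed_kernels K g))"
  obtains \<nu> where "\<nu> \<in> regular_measures" "f = kernel_integral K \<nu>" "tv_norm \<nu> \<le> sup_norm g"
    "signed_integral \<nu> g = sup_norm g * sup_norm g"
proof -
  let ?s = "sup_norm g" and ?N = "norming_points g"
  let ?F = "\<lambda>t. sgn (g t) *\<^sub>R (\<lambda>u. K u t)"
  obtain v where v: "v \<in> convex hull (?F ` ?N)" "f = ?s *\<^sub>R v"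
    using f by (auto simp: signed_kernels_def)
  obtain w where w: "\<And>t. t \<in> ?N \<Longrightarrow> 0 \<le> w t" "sum w ?N = 1" "v = (\<Sum>t\<in>?N. w t *\<^sub>R ?F t)"
    using convex_hull_image_finite[OF N v(1)] by blast
  define a where "a t = ?s * (w t * sgn (g t))" for t
  have s: "0 \<le> ?s" using g by (rule sup_norm_nonneg)
  show thesis
  proof (rule that[of "point_masses ?N a"])
    show "point_masses ?N a \<in> regular_measures" using N by (rule point_masses_regular)
    show "f = kernel_integral K (point_masses ?N a)"
      by (simp add: kernel_integral_point_masses[OF N K] v(2) w(3) a_def scaleR_sum_right)
    have "tv_norm (point_masses ?N a) = (\<Sum>t\<in>?N. \<bar>a t\<bar>)"
      using N by (rule tv_norm_point_masses)
    also have "\<dots> \<le> (\<Sum>t\<in>?N. ?s * w t)"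
    proof (rule sum_mono)
      fix t assume "t \<in> ?N"
      then show "\<bar>a t\<bar> \<le> ?s * w t"
        using s w(1)[of t] by (auto simp: a_def abs_mult sgn_if)
    qed
    also have "\<dots> = ?s" using w(2) by (simp flip: sum_distrib_left)
    finally show "tv_norm (point_masses ?N a) \<le> ?s" .
    have "signed_integral (point_masses ?N a) g = (\<Sum>t\<in>?N. g t * a t)"
      using N C0_measurable[OF g] by (rule signed_integral_point_masses)
    also have "\<dots> = (\<Sum>t\<in>?N. ?s * ?s * w t)"
    proof (rule sum.cong[OF refl])
      fix t assume "t \<in> ?N"
      then have "g t * sgn (g t) = ?s"
        by (simp add: norming_points_def abs_sgn)
      then show "g t * a t = ?s * ?s * w t" by (simp add: a_def algebra_simps)
    qed
    also have "\<dots> = ?s * ?s" using w(2) by (simp flip: sum_distrib_left)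
    finally show "signed_integral (point_masses ?N a) g = ?s * ?s" .
  qed
qed

text \<open>
  This is the size of a perturbation that does not make any of the nonzero numbers \<open>a t\<close> change
  sign.
\<close>

lemma exists_uniform_scaling:
  assumes "finite P" "\<And>t. t \<in> P \<Longrightarrow> a t \<noteq> (0::real)"
  shows "\<exists>\<epsilon>>0. \<forall>t\<in>P. \<epsilon> * \<bar>b t\<bar> \<le> \<bar>a t\<bar>"
  using assms
proof (induction P rule: finite_induct)
  case empty
  then show ?case by (intro exI[of _ 1]) simp
next
  case (insert s P)
  then obtain \<epsilon> where \<epsilon>: "\<epsilon> > 0" "\<forall>t\<in>P. \<epsilon> * \<bar>b t\<bar> \<le> \<bar>a t\<bar>" by auto
  \<comment> \<open>The summand 1 keeps the quotient defined when \<open>b s\<close> is zero.\<close>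
  define \<delta> where "\<delta> = min \<epsilon> (\<bar>a s\<bar> / (\<bar>b s\<bar> + 1))"
  have "0 < \<delta>" using \<epsilon>(1) insert.prems by (auto simp: \<delta>_def add_nonneg_pos)
  moreover have "\<delta> * \<bar>b t\<bar> \<le> \<bar>a t\<bar>" if "t \<in> P" for t
  proof -
    have "\<delta> * \<bar>b t\<bar> \<le> \<epsilon> * \<bar>b t\<bar>" by (intro mult_right_mono) (auto simp: \<delta>_def)
    then show ?thesis using \<epsilon>(2) that by auto
  qed
  moreover have "\<delta> * \<bar>b s\<bar> \<le> \<bar>a s\<bar>"
  proof -
    have "\<delta> * \<bar>b s\<bar> \<le> \<bar>a s\<bar> / (\<bar>b s\<bar> + 1) * (\<bar>b s\<bar> + 1)"
      using \<open>0 < \<delta>\<close> by (intro mult_mono) (auto simp: \<delta>_def)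
    then show ?thesis by (simp add: add_nonneg_pos less_imp_neq[symmetric])
  qed
  ultimately show ?case by (intro exI[of _ \<delta>]) auto
qed

context dense_kernel
begin

text \<open>
  A linear relation \<open>b\<close> between the columns can be added to the coefficients \<open>a\<close> without changing the
  interpolated values. As long as no coefficient changes sign, it also leaves the norm unchanged:
  \<open>sup_norm g\<close> times the norm is the integral of \<open>g\<close>, and the integral of \<open>g\<close> is zero against \<open>b\<close>,
  because \<open>g\<close> lies in the span of the \<open>K (x j)\<close>. So \<open>a + \<epsilon> b\<close> and \<open>a - \<epsilon> b\<close> both give minimal norm
  interpolants with midpoint \<open>a\<close>. At an extreme point the two must represent the same function,
  and by injectivity they have the same masses.
\<close>

lemma extreme_point_indep:
  assumes g: "g \<in> span ((\<lambda>j. K (x j)) ` {..<n})" "0 < sup_norm g"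
    and \<nu>: "\<nu> \<in> regular_measures" "kernel_integral K \<nu> \<in> interpolants K n x y"
      "tv_norm \<nu> \<le> sup_norm g" "signed_integral \<nu> g = sup_norm g * sup_norm g"
    and P: "finite P" "\<And>t. t \<in> P \<Longrightarrow> a t \<noteq> 0" "\<And>t. t \<in> P \<Longrightarrow> g t * a t = sup_norm g * \<bar>a t\<bar>"
    and extreme: "(\<Sum>t\<in>P. a t *\<^sub>R (\<lambda>u. K u t)) extreme_point_of min_norm_interpolants K n x y"
    and b: "\<And>i. i < n \<Longrightarrow> (\<Sum>t\<in>P. b t * K (x i) t) = 0"
  shows "\<forall>t\<in>P. b t = 0"
proof -
  let ?s = "sup_norm g"
  let ?f = "\<lambda>a. kernel_integral K (point_masses P a)"
  have f_eq: "?f a = (\<Sum>t\<in>P. a t *\<^sub>R (\<lambda>u. K u t))" for a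
    using P(1) kernel_C0 by (rule kernel_integral_point_masses)
  have ext: "?f a extreme_point_of min_norm_interpolants K n x y"
    using extreme by (simp only: f_eq)
  then have "?f a \<in> min_norm_interpolants K n x y" by (simp add: extreme_point_of_def)
  then have fa: "?f a \<in> interpolants K n x y" "tv_norm (point_masses P a) = ?s"
    using min_norm_interpolants_eq(1)[OF g \<nu> point_masses_regular[OF P(1)]] by auto
  have sub: "(\<lambda>j. K (x j)) ` {..<n} \<subseteq> C0" using kernel_C0 by auto
  then have gC: "g \<in> C0" using g(1) span_subset_C0 by blast
  have int: "signed_integral (point_masses P c) h = (\<Sum>t\<in>P. h t * c t)" if "h \<in> C0" for c h
    using P(1) C0_measurable[OF that] by (rule signed_integral_point_masses)
  have "signed_integral (point_masses P b) g = signed_integral (point_masses P (\<lambda>_. 0)) g"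
  proof (rule signed_integral_eq_on_span[OF point_masses_signed[OF P(1)]
        point_masses_signed[OF P(1)] sub _ g(1)])
    fix h assume "h \<in> (\<lambda>j. K (x j)) ` {..<n}"
    then show "signed_integral (point_masses P b) h = signed_integral (point_masses P (\<lambda>_. 0)) h"
      using b int kernel_C0 by (auto simp: mult.commute)
  qed
  then have bg: "(\<Sum>t\<in>P. g t * b t) = 0" using int[OF gC] by simp
  obtain \<epsilon> where \<epsilon>: "\<epsilon> > 0" "\<And>t. t \<in> P \<Longrightarrow> \<epsilon> * \<bar>b t\<bar> \<le> \<bar>a t\<bar>"
    using exists_uniform_scaling[OF P(1), of a b] P(2) by blast
  have perturbed: "?f (\<lambda>t. a t + c * b t) \<in> min_norm_interpolants K n x y" if c: "\<bar>c\<bar> = \<epsilon>" for c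
  proof -
    let ?a = "\<lambda>t. a t + c * b t"
    have "?s * \<bar>?a t\<bar> = g t * ?a t" if t: "t \<in> P" for t
    proof -
      have "g t * a t = ?s * sgn (a t) * a t"
        using P(3)[OF t] by (simp add: sgn_if)
      then have "g t = ?s * sgn (a t)" using P(2)[OF t] by simp
      moreover have "\<bar>c * b t\<bar> \<le> \<bar>a t\<bar>" using \<epsilon>(2)[OF t] c by (simp add: abs_mult)
      then have "\<bar>?a t\<bar> = sgn (a t) * ?a t"
        using P(2)[OF t] by (auto simp: sgn_if)
      ultimately show ?thesis by simp
    qed
    then have "?s * (\<Sum>t\<in>P. \<bar>?a t\<bar>) = (\<Sum>t\<in>P. g t * ?a t)"
      by (simp add: sum_distrib_left)
    also have "\<dots> = (\<Sum>t\<in>P. g t * a t)"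
      using bg by (simp add: distrib_left sum.distrib mult.left_commute[of _ c] flip: sum_distrib_left)
    also have "\<dots> = ?s * (\<Sum>t\<in>P. \<bar>a t\<bar>)"
      using P(3) by (simp add: sum_distrib_left)
    finally have "(\<Sum>t\<in>P. \<bar>?a t\<bar>) = (\<Sum>t\<in>P. \<bar>a t\<bar>)" using g(2) by simp
    then have "tv_norm (point_masses P ?a) = ?s"
      using fa(2) P(1) by (simp add: tv_norm_point_masses)
    moreover have "?f ?a \<in> interpolants K n x y"
    proof -
      have "?f ?a (x i) = ?f a (x i)" if "i < n" for i
      proof -
        have "(\<Sum>t\<in>P. K (x i) t * ?a t) = (\<Sum>t\<in>P. K (x i) t * a t) + c * (\<Sum>t\<in>P. b t * K (x i) t)"
          by (simp add: sum.distrib sum_distrib_left algebra_simps)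
        then show ?thesis
          using b[OF that] by (simp add: kernel_integral_def int kernel_C0)
      qed
      then show ?thesis
        using fa(1) point_masses_regular[OF P(1), of ?a] by (auto simp: interpolants_def rkbs_def)
    qed
    ultimately show ?thesis
      using min_norm_interpolants_eq(1)[OF g \<nu> point_masses_regular[OF P(1)]] by simp
  qed
  let ?p = "\<lambda>t. a t + \<epsilon> * b t" and ?m = "\<lambda>t. a t + (- \<epsilon>) * b t"
  have "?f a = (1 - 1 / 2) *\<^sub>R ?f ?p + (1 / 2) *\<^sub>R ?f ?m"
  proof
    fix u
    have "(\<Sum>t\<in>P. a t * K u t) = (\<Sum>t\<in>P. (1 / 2) * (?p t * K u t) + (1 / 2) * (?m t * K u t))"
      by (intro sum.cong) (simp_all add: field_simps)
    also have "\<dots> = (1 / 2) * (\<Sum>t\<in>P. ?p t * K u t) + (1 / 2) * (\<Sum>t\<in>P. ?m t * K u t)"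
      by (simp only: sum.distrib sum_distrib_left)
    finally show "?f a u = ((1 - 1 / 2) *\<^sub>R ?f ?p + (1 / 2) *\<^sub>R ?f ?m) u"
      unfolding f_eq by (simp add: sum_fun_apply scaleR_fun_def)
  qed
  moreover have "?f a \<notin> open_segment (?f ?p) (?f ?m)"
    using ext perturbed[of \<epsilon>] perturbed[of "- \<epsilon>"] \<epsilon>(1) by (simp add: extreme_point_of_def)
  moreover have "0 < (1 / 2 :: real)" "(1 / 2 :: real) < 1" by auto
  ultimately have "?f ?p = ?f ?m"
    unfolding in_segment(2) by blast
  then have "point_masses P ?p = point_masses P ?m"
    using P(1) by (intro kernel_integral_inj point_masses_regular)
  then have "?p t = ?m t" if "t \<in> P" for t
    using point_masses_singleton[OF that, of ?p] point_masses_singleton[OF that, of ?m] by simp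
  then show ?thesis using \<epsilon>(1) by auto
qed

end

theorem theorem28:
  fixes K :: "'a \<Rightarrow> 'b::t2_space \<Rightarrow> real"
    and n :: nat
    and x :: "nat \<Rightarrow> 'a"
    and y :: "nat \<Rightarrow> real"
    and g_hat :: "'b \<Rightarrow> real"
    and f_hat :: "'a \<Rightarrow> real"
  assumes "locally_compact_space (euclidean :: 'b topology)"
    and "\<And>u. K u \<in> C0"
    and dense: "\<And>h \<epsilon>. h \<in> C0 \<Longrightarrow> \<epsilon> > 0 \<Longrightarrow> \<exists>g \<in> span (range K). sup_norm (h - g) < \<epsilon>"
    and "inj_on x {..<n}"
    and lin_indep: "inj_on (\<lambda>j. K (x j)) {..<n}" "independent ((\<lambda>j. K (x j)) ` {..<n})"
    and y_nonzero: "\<exists>j<n. y j \<noteq> 0"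
    and "g_hat \<in> span ((\<lambda>j. K (x j)) ` {..<n})"
    and "((\<lambda>h. sup_norm g_hat *\<^sub>R h) ` (convex hull (signed_kernels K g_hat)))
           \<inter> interpolants K n x y \<noteq> {}"
    and "\<And>g. g \<in> span ((\<lambda>j. K (x j)) ` {..<n}) \<Longrightarrow> g \<noteq> 0 \<Longrightarrow> finite (norming_points g)"
    and "f_hat extreme_point_of (min_norm_interpolants K n x y)"
  shows "\<exists>(M :: nat) (\<alpha> :: nat \<Rightarrow> real) (p :: nat \<Rightarrow> 'b).
           0 < M \<and> M \<le> vec_space.rank n (kernel_matrix K n x g_hat) \<and>
           (\<forall>j<M. \<alpha> j \<noteq> 0) \<and>
           (\<Sum>j<M. \<bar>\<alpha> j\<bar>) = sup_norm g_hat \<and>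
           (\<forall>j<M. p j \<in> norming_points g_hat) \<and>
           f_hat = (\<Sum>j<M. \<alpha> j *\<^sub>R (\<lambda>u. K u (p j)))"
proof -
  interpret dense_kernel K using assms(1-3) by unfold_locales
  let ?N = "norming_points g_hat" and ?s = "sup_norm g_hat"
  note g_span = \<open>g_hat \<in> span ((\<lambda>j. K (x j)) ` {..<n})\<close>
  have "(\<lambda>j. K (x j)) ` {..<n} \<subseteq> C0" using kernel_C0 by (rule image_subsetI)
  then have gC: "g_hat \<in> C0" using g_span span_subset_C0 by blast
  obtain f where f: "f \<in> (\<lambda>h. ?s *\<^sub>R h) ` (convex hull (signed_kernels K g_hat))"
    "f \<in> interpolants K n x y"
    using assms(9) by blast
  \<comment> \<open>Otherwise the scaled convex hull would contain only the zero function.\<close>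
  have s: "0 < ?s"
  proof (rule ccontr)
    assume "\<not> 0 < ?s"
    then have "?s = 0" using sup_norm_nonneg[OF gC] by simp
    then have "f u = 0" for u using f(1) by (auto simp: scaleR_fun_def)
    then show False using y_nonzero f(2) by (auto simp: interpolants_def)
  qed
  then have "g_hat \<noteq> 0" by (auto simp: sup_norm_def)
  then have N: "finite ?N" using g_span assms(10) by simp
  obtain \<nu> where \<nu>: "\<nu> \<in> regular_measures" "f = kernel_integral K \<nu>" "tv_norm \<nu> \<le> ?s"
    "signed_integral \<nu> g_hat = ?s * ?s"
    using certificate_measure[OF kernel_C0 gC N f(1)] .
  have \<nu>_int: "kernel_integral K \<nu> \<in> interpolants K n x y" using f(2) \<nu>(2) by simp
  have f_hat: "f_hat \<in> min_norm_interpolants K n x y"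
    using assms(11) by (simp add: extreme_point_of_def)
  then obtain \<mu> where \<mu>: "\<mu> \<in> regular_measures" "f_hat = kernel_integral K \<mu>"
    by (auto simp: min_norm_interpolants_def interpolants_def rkbs_def)
  note opt = min_norm_interpolants_eq[OF g_span s \<nu>(1) \<nu>_int \<nu>(3,4) \<mu>(1)]
  have \<mu>_opt: "kernel_integral K \<mu> \<in> interpolants K n x y" "tv_norm \<mu> = ?s"
    using opt(1) f_hat \<mu>(2) by auto
  have "signed_integral \<mu> g_hat = ?s * tv_norm \<mu>"
    using opt(2)[OF \<mu>_opt(1)] \<mu>_opt(2) by simp
  note rep = norm_attaining_measure[OF regular_measures_signed[OF \<mu>(1)] gC N this]
  \<comment> \<open>The measure of \<open>f_hat\<close> attains the norm of \<open>g_hat\<close>, so it is a finite sum of point masses.\<close>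
  define a where "a t = \<mu> {t}" for t
  define P where "P = {t \<in> ?N. a t \<noteq> 0}"
  have P: "finite P" "P \<subseteq> ?N" using N by (auto simp: P_def)
  have "f_hat = (\<Sum>t\<in>?N. a t *\<^sub>R (\<lambda>u. K u t))"
    using rep(1)[OF C0_measurable[OF kernel_C0]]
    by (simp add: \<mu>(2) fun_eq_iff kernel_integral_def sum_fun_apply scaleR_fun_def a_def mult.commute)
  also have "\<dots> = (\<Sum>t\<in>P. a t *\<^sub>R (\<lambda>u. K u t))"
    using N by (intro sum.mono_neutral_right) (auto simp: P_def)
  finally have f_P: "f_hat = (\<Sum>t\<in>P. a t *\<^sub>R (\<lambda>u. K u t))" .
  have "?s = (\<Sum>t\<in>?N. \<bar>a t\<bar>)" using rep(2) \<mu>_opt(2) by (simp add: a_def)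
  also have "\<dots> = (\<Sum>t\<in>P. \<bar>a t\<bar>)"
    using N by (intro sum.mono_neutral_right) (auto simp: P_def)
  finally have s_P: "?s = (\<Sum>t\<in>P. \<bar>a t\<bar>)" .
  have "card P \<le> vec_space.rank n (kernel_matrix K n x g_hat)"
  proof (rule card_le_rank_kernel_matrix[OF N P(2)])
    fix b assume b: "\<And>i. i < n \<Longrightarrow> (\<Sum>t\<in>P. b t * K (x i) t) = 0"
    show "\<forall>t\<in>P. b t = 0"
    proof (rule extreme_point_indep[OF g_span s \<nu>(1) \<nu>_int \<nu>(3,4) P(1) _ _ _ b])
      show "a t \<noteq> 0" "g_hat t * a t = ?s * \<bar>a t\<bar>" if "t \<in> P" for t
        using that rep(3)[of t] by (auto simp: P_def a_def)
      show "(\<Sum>t\<in>P. a t *\<^sub>R (\<lambda>u. K u t)) extreme_point_of min_norm_interpolants K n x y"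
        using assms(11) f_P by simp
    qed
  qed
  moreover have "0 < card P"
  proof (rule ccontr)
    assume "\<not> 0 < card P"
    then have "P = {}" using P(1) by simp
    then show False using s s_P by simp
  qed
  moreover obtain p where p: "bij_betw p {..<card P} P"
    using ex_bij_betw_nat_finite[OF P(1)] by (auto simp: atLeast0LessThan)
  ultimately show ?thesis
  proof (intro exI[of _ "card P"] exI[of _ "\<lambda>j. a (p j)"] exI[of _ p] conjI allI impI)
    fix j assume "j < card P"
    then have "p j \<in> P" using p by (auto simp: bij_betw_def)
    then show "a (p j) \<noteq> 0" "p j \<in> ?N" by (auto simp: P_def)
  next
    show "(\<Sum>j<card P. \<bar>a (p j)\<bar>) = ?s"
      unfolding s_P by (rule sum.reindex_bij_betw[OF p])
    show "f_hat = (\<Sum>j<card P. a (p j) *\<^sub>R (\<lambda>u. K u (p j)))"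
      unfolding f_P by (rule sum.reindex_bij_betw[OF p, symmetric])
  qed
qed

end
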